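(* Let $A$ be an algebra with an idempotent grading and a graded pre-Borelic subalgebra $B$ such that $H=B_0$ is standardly based. Then $(A,\mathcal Q)$ is base stratified, where $\mathcal Q$ is the decomposition $\Lambda=\bigsqcup_{i=0}^n\Lambda_i$ with $\Lambda_i=\{\lambda\in\Lambda:F_A(\lambda)=i\}$.
   Context: All algebras are finite-dimensional, associative and unital over a field $\Bbbk$; modules are finitely generated left modules; $\Lambda$ indexes simple $A$-modules $L(\lambda)$ with primitive idempotents $e_\lambda$; idempotents $e,f$ are equivalent if $Ae\cong Af$. Idempotent grading: mutually orthogonal (possibly zero) idempotents $1_A=e^\ast_0+\cdots+e^\ast_n$, $A_j=\bigoplus_ie^\ast_iAe^\ast_{i+j}$, $A_-=\bigoplus_{j<0}A_j$. A graded pre-Borelic subalgebra is a graded subalgebra $B$ with $B_j=0$ for $j<0$, $A=B\oplus A_-B$, $A$ projective as right $B$-module and $B$ projective as left $B_0$-module. $F_A(\lambda)$ is the least $i$ such that there is an idempotent in $e^\ast_iAe^\ast_i$ equivalent to $e_\lambda$. Standardly based structure: poset $(L,\le)$ and two-sided ideals $A^{\ge p}$ with $A^{\ge p}\supseteq A^{\ge q}$ for $p<q$; with $A^{>p}$ the sum of $A^{\ge q}$, $q>p$, there are complements $A^{(p)}$ of $A^{>p}$ in $A^{\ge p}$ with $\bigoplus_pA^{(p)}=A$ and $A^{\ge p}/A^{>p}\cong W(p)\otimes_\Bbbk W'(p)$ as bimodules. For an $n$-decomposition $\Lambda=\bigsqcup_{i=0}^n\Lambda_i$, let $J_0=0$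 and $J_i$ ($1\le i\le n+1$) be the two-sided ideal generated by the $e_\lambda$ with $\lambda\in\Lambda_0\cup\cdots\cup\Lambda_{i-1}$. An idempotent ideal $J=AeA$ is base stratifying if it is projective as left and as right $A$-module and $eAe$ is standardly based. $(A,\mathcal Q)$ is base stratified if $J_i/J_{i-1}$ is a base stratifying ideal of $A/J_{i-1}$ for each $1\le i\le n+1$.
   Formalization: The poset of a standardly based structure is taken to be finite; with infinite posets the literal definition is too loose and the claim fails, e.g. for R×C over R graded by its two block idempotents. *)

theory Defs
  imports Main "HOL.Vector_Spaces"
begin

definition kalg :: "('k::field \<Rightarrow> 'a::ring_1 \<Rightarrow> 'a) \<Rightarrow> bool" where
  "kalg sc \<longleftrightarrow> vector_space sc
     \<and> (\<forall>c a b. sc c (a * b) = sc c a * b \<and> sc c (a * b) = a * sc c b)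
     \<and> (\<exists>S. finite S \<and> module.span sc S = UNIV)"

definition ksum :: "'a::plus set \<Rightarrow> 'a set \<Rightarrow> 'a set" where
  "ksum X Y = {x + y | x y. x \<in> X \<and> y \<in> Y}"

definition ideal_gen :: "('k::field \<Rightarrow> 'a::ring_1 \<Rightarrow> 'a) \<Rightarrow> 'a set \<Rightarrow> 'a set" where
  "ideal_gen sc S = module.span sc {a * s * b | a s b. s \<in> S}"

(* M/N is a finitely generated projective left module over the algebra R/Rn,
   i.e. a direct summand of a free module (R/Rn)^n: maps f = (phi_i) : M/N -> (R/Rn)^n and
   g(r) = sum r_i x_i : (R/Rn)^n -> M/N, both linear, with g o f = id.  All equalities modulo N resp. Rn. *)
definition left_proj :: "('k::field \<Rightarrow> 'a::ring_1 \<Rightarrow> 'a) \<Rightarrow> 'a set \<Rightarrow> 'a set \<Rightarrow> 'a set \<Rightarrow> 'a set \<Rightarrow> bool" where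
  "left_proj sc R Rn M N \<longleftrightarrow> (\<exists>(n::nat) (\<phi>::nat \<Rightarrow> 'a \<Rightarrow> 'a) (x::nat \<Rightarrow> 'a).
      (\<forall>i<n. x i \<in> M)
    \<and> (\<forall>i<n. \<forall>m\<in>M. \<phi> i m \<in> R)
    \<and> (\<forall>i<n. \<forall>m\<in>N. \<phi> i m \<in> Rn)
    \<and> (\<forall>i<n. \<forall>m\<in>M. \<forall>m'\<in>M. \<phi> i (m + m') - (\<phi> i m + \<phi> i m') \<in> Rn)
    \<and> (\<forall>i<n. \<forall>c. \<forall>m\<in>M. \<phi> i (sc c m) - sc c (\<phi> i m) \<in> Rn)
    \<and> (\<forall>i<n. \<forall>r\<in>R. \<forall>m\<in>M. \<phi> i (r * m) - r * \<phi> i m \<in> Rn)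
    \<and> (\<forall>m\<in>M. m - (\<Sum>i<n. \<phi> i m * x i) \<in> N))"

definition right_proj :: "('k::field \<Rightarrow> 'a::ring_1 \<Rightarrow> 'a) \<Rightarrow> 'a set \<Rightarrow> 'a set \<Rightarrow> 'a set \<Rightarrow> 'a set \<Rightarrow> bool" where
  "right_proj sc R Rn M N \<longleftrightarrow> (\<exists>(n::nat) (\<phi>::nat \<Rightarrow> 'a \<Rightarrow> 'a) (x::nat \<Rightarrow> 'a).
      (\<forall>i<n. x i \<in> M)
    \<and> (\<forall>i<n. \<forall>m\<in>M. \<phi> i m \<in> R)
    \<and> (\<forall>i<n. \<forall>m\<in>N. \<phi> i m \<in> Rn)
    \<and> (\<forall>i<n. \<forall>m\<in>M. \<forall>m'\<in>M. \<phi> i (m + m') - (\<phi> i m + \<phi> i m') \<in> Rn)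
    \<and> (\<forall>i<n. \<forall>c. \<forall>m\<in>M. \<phi> i (sc c m) - sc c (\<phi> i m) \<in> Rn)
    \<and> (\<forall>i<n. \<forall>r\<in>R. \<forall>m\<in>M. \<phi> i (m * r) - \<phi> i m * r \<in> Rn)
    \<and> (\<forall>m\<in>M. m - (\<Sum>i<n. x i * \<phi> i m) \<in> N))"

(* Layer condition: G/T (a C/N-bimodule) is isomorphic to W (x)_k W' with W a left and
   W' a right C/N-module, written in bases: W has basis w_0..w_{m-1} with a.w_i = sum_k rho a k i w_k,
   W' has basis w'_0..w'_{m'-1} with w'_j.a = sum_l rho' a j l w'_l, and the bimodule map
   w_i (x) w'_j |-> class of x i j is an isomorphism onto G/T. *)
definition layer_tensor :: "('k::field \<Rightarrow> 'a::ring_1 \<Rightarrow> 'a) \<Rightarrow> 'a set \<Rightarrow> 'a \<Rightarrow> 'a set \<Rightarrow> 'a set \<Rightarrow> 'a set \<Rightarrow> bool" where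
  "layer_tensor sc C u N G T \<longleftrightarrow> (\<exists>(m::nat) (m'::nat) (x::nat \<Rightarrow> nat \<Rightarrow> 'a)
        (\<rho>::'a \<Rightarrow> nat \<Rightarrow> nat \<Rightarrow> 'k) (\<rho>'::'a \<Rightarrow> nat \<Rightarrow> nat \<Rightarrow> 'k).
      \<comment> \<open>W is a left C/N-module\<close>
      (\<forall>a\<in>C. \<forall>b\<in>C. \<forall>k<m. \<forall>i<m. \<rho> (a * b) k i = (\<Sum>l<m. \<rho> a k l * \<rho> b l i))
    \<and> (\<forall>k<m. \<forall>i<m. \<rho> u k i = (if k = i then 1 else 0))
    \<and> (\<forall>a\<in>C. \<forall>b\<in>C. \<forall>k<m. \<forall>i<m. \<rho> (a + b) k i = \<rho> a k i + \<rho> b k i)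
    \<and> (\<forall>c. \<forall>a\<in>C. \<forall>k<m. \<forall>i<m. \<rho> (sc c a) k i = c * \<rho> a k i)
    \<and> (\<forall>a\<in>N. \<forall>k<m. \<forall>i<m. \<rho> a k i = 0)
      \<comment> \<open>W' is a right C/N-module\<close>
    \<and> (\<forall>a\<in>C. \<forall>b\<in>C. \<forall>j<m'. \<forall>l<m'. \<rho>' (a * b) j l = (\<Sum>t<m'. \<rho>' a j t * \<rho>' b t l))
    \<and> (\<forall>j<m'. \<forall>l<m'. \<rho>' u j l = (if j = l then 1 else 0))
    \<and> (\<forall>a\<in>C. \<forall>b\<in>C. \<forall>j<m'. \<forall>l<m'. \<rho>' (a + b) j l = \<rho>' a j l + \<rho>' b j l)
    \<and> (\<forall>c. \<forall>a\<in>C. \<forall>j<m'. \<forall>l<m'. \<rho>' (sc c a) j l = c * \<rho>' a j l)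
    \<and> (\<forall>a\<in>N. \<forall>j<m'. \<forall>l<m'. \<rho>' a j l = 0)
      \<comment> \<open>the classes of x i j form a k-basis of G/T\<close>
    \<and> (\<forall>i<m. \<forall>j<m'. x i j \<in> G)
    \<and> (\<forall>c::nat \<Rightarrow> nat \<Rightarrow> 'k. (\<Sum>i<m. \<Sum>j<m'. sc (c i j) (x i j)) \<in> T
           \<longrightarrow> (\<forall>i<m. \<forall>j<m'. c i j = 0))
    \<and> (\<forall>y\<in>G. \<exists>c::nat \<Rightarrow> nat \<Rightarrow> 'k. y - (\<Sum>i<m. \<Sum>j<m'. sc (c i j) (x i j)) \<in> T)
      \<comment> \<open>the map is a bimodule map\<close>
    \<and> (\<forall>a\<in>C. \<forall>i<m. \<forall>j<m'. a * x i j - (\<Sum>k<m. sc (\<rho> a k i) (x k j)) \<in> T)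
    \<and> (\<forall>a\<in>C. \<forall>i<m. \<forall>j<m'. x i j * a - (\<Sum>l<m'. sc (\<rho>' a j l) (x i l)) \<in> T))"

(* The algebra C/N (C closed under the ring operations with unit u, N a two-sided ideal of C)
   is standardly based.  Ideals of C/N are represented by subspaces between N and C. *)
definition std_based :: "('k::field \<Rightarrow> 'a::ring_1 \<Rightarrow> 'a) \<Rightarrow> 'a set \<Rightarrow> 'a \<Rightarrow> 'a set \<Rightarrow> bool" where
  "std_based sc C u N \<longleftrightarrow> (\<exists>(L::nat set) (le::nat \<Rightarrow> nat \<Rightarrow> bool) (Age::nat \<Rightarrow> 'a set) (Acomp::nat \<Rightarrow> 'a set).
     let Agt = (\<lambda>p. module.span sc (N \<union> \<Union>{Age q | q. q \<in> L \<and> le p q \<and> p \<noteq> q})) in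
      finite L
    \<and> (\<forall>p\<in>L. le p p)
    \<and> (\<forall>p\<in>L. \<forall>q\<in>L. le p q \<and> le q p \<longrightarrow> p = q)
    \<and> (\<forall>p\<in>L. \<forall>q\<in>L. \<forall>r\<in>L. le p q \<and> le q r \<longrightarrow> le p r)
    \<and> (\<forall>p\<in>L. module.subspace sc (Age p) \<and> N \<subseteq> Age p \<and> Age p \<subseteq> C
             \<and> (\<forall>a\<in>C. \<forall>y\<in>Age p. a * y \<in> Age p \<and> y * a \<in> Age p))
    \<and> (\<forall>p\<in>L. \<forall>q\<in>L. le p q \<and> p \<noteq> q \<longrightarrow> Age q \<subseteq> Age p)
    \<and> (\<forall>p\<in>L. module.subspace sc (Acomp p) \<and> N \<subseteq> Acomp p \<and> Acomp p \<subseteq> Age p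
             \<and> ksum (Acomp p) (Agt p) = Age p \<and> Acomp p \<inter> Agt p = N)
    \<and> module.span sc (N \<union> (\<Union>p\<in>L. Acomp p)) = C
    \<and> (\<forall>y::nat \<Rightarrow> 'a. (\<forall>p\<in>L. y p \<in> Acomp p) \<and> (\<Sum>p\<in>L. y p) \<in> N \<longrightarrow> (\<forall>p\<in>L. y p \<in> N))
    \<and> (\<forall>p\<in>L. layer_tensor sc C u N (Age p) (Agt p)))"

definition idem_grading :: "nat \<Rightarrow> (nat \<Rightarrow> 'a::ring_1) \<Rightarrow> bool" where
  "idem_grading n es \<longleftrightarrow> (\<forall>i\<le>n. es i * es i = es i)
     \<and> (\<forall>i\<le>n. \<forall>j\<le>n. i \<noteq> j \<longrightarrow> es i * es j = 0)
     \<and> (\<Sum>i\<le>n. es i) = 1"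

definition grade :: "('k::field \<Rightarrow> 'a::ring_1 \<Rightarrow> 'a) \<Rightarrow> nat \<Rightarrow> (nat \<Rightarrow> 'a) \<Rightarrow> int \<Rightarrow> 'a set" where
  "grade sc n es j = module.span sc
     {es i * a * es (nat (int i + j)) | i a. i \<le> n \<and> 0 \<le> int i + j \<and> int i + j \<le> int n}"

definition Aneg :: "('k::field \<Rightarrow> 'a::ring_1 \<Rightarrow> 'a) \<Rightarrow> nat \<Rightarrow> (nat \<Rightarrow> 'a) \<Rightarrow> 'a set" where
  "Aneg sc n es = module.span sc (\<Union>j\<in>{j. j < 0}. grade sc n es j)"

definition graded_subalg :: "('k::field \<Rightarrow> 'a::ring_1 \<Rightarrow> 'a) \<Rightarrow> nat \<Rightarrow> (nat \<Rightarrow> 'a) \<Rightarrow> 'a set \<Rightarrow> bool" where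
  "graded_subalg sc n es B \<longleftrightarrow> module.subspace sc B \<and> 1 \<in> B \<and> (\<forall>a\<in>B. \<forall>b\<in>B. a * b \<in> B)
     \<and> B = module.span sc (\<Union>j. B \<inter> grade sc n es j)"

definition graded_pre_Borelic :: "('k::field \<Rightarrow> 'a::ring_1 \<Rightarrow> 'a) \<Rightarrow> nat \<Rightarrow> (nat \<Rightarrow> 'a) \<Rightarrow> 'a set \<Rightarrow> bool" where
  "graded_pre_Borelic sc n es B \<longleftrightarrow> graded_subalg sc n es B
     \<and> (\<forall>j<0. B \<inter> grade sc n es j = {0})
     \<and> (let AnB = module.span sc {x * b | x b. x \<in> Aneg sc n es \<and> b \<in> B}
        in ksum B AnB = UNIV \<and> B \<inter> AnB = {0})
     \<and> right_proj sc B {0} UNIV {0}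
     \<and> left_proj sc (B \<inter> grade sc n es 0) {0} B {0}"

definition primitive_idem :: "'a::ring_1 \<Rightarrow> bool" where
  "primitive_idem e \<longleftrightarrow> e \<noteq> 0 \<and> e * e = e \<and>
     \<not> (\<exists>f g. f \<noteq> 0 \<and> g \<noteq> 0 \<and> f * f = f \<and> g * g = g \<and> f * g = 0 \<and> g * f = 0 \<and> e = f + g)"

definition idem_equiv :: "('k::field \<Rightarrow> 'a::ring_1 \<Rightarrow> 'a) \<Rightarrow> 'a \<Rightarrow> 'a \<Rightarrow> bool" where
  "idem_equiv sc e f \<longleftrightarrow> (\<exists>\<phi>. bij_betw \<phi> {a * e | a. True} {a * f | a. True}
      \<and> (\<forall>x\<in>{a * e | a. True}. \<forall>y\<in>{a * e | a. True}. \<phi> (x + y) = \<phi> x + \<phi> y)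
      \<and> (\<forall>c. \<forall>x\<in>{a * e | a. True}. \<phi> (sc c x) = sc c (\<phi> x))
      \<and> (\<forall>a. \<forall>x\<in>{a * e | a. True}. \<phi> (a * x) = a * \<phi> x))"

(* F_A(lambda) for lambda represented by the primitive idempotent e *)
definition F_A :: "('k::field \<Rightarrow> 'a::ring_1 \<Rightarrow> 'a) \<Rightarrow> nat \<Rightarrow> (nat \<Rightarrow> 'a) \<Rightarrow> 'a \<Rightarrow> nat" where
  "F_A sc n es e = (LEAST i. i \<le> n \<and> (\<exists>f. f \<in> {es i * a * es i | a. True} \<and> f * f = f \<and> idem_equiv sc f e))"

(* J_i: ideal generated by e_lambda, lambda in Lambda_0 \<union> ... \<union> Lambda_{i-1}, where
   Lambda_k = {lambda. F_A(lambda) = k}; J_0 = span {} = 0. *)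
definition Jideal :: "('k::field \<Rightarrow> 'a::ring_1 \<Rightarrow> 'a) \<Rightarrow> nat \<Rightarrow> (nat \<Rightarrow> 'a) \<Rightarrow> nat \<Rightarrow> 'a set" where
  "Jideal sc n es i = ideal_gen sc {e. primitive_idem e \<and> F_A sc n es e < i}"

(* J/I is a base stratifying ideal of A/I (I \<subseteq> J ideals of A):
   J/I = (A/I) e (A/I) for an idempotent e of A/I, projective as left and right A/I-module,
   and e(A/I)e = eAe/(I \<inter> eAe) standardly based. *)
definition base_strat_ideal :: "('k::field \<Rightarrow> 'a::ring_1 \<Rightarrow> 'a) \<Rightarrow> 'a set \<Rightarrow> 'a set \<Rightarrow> bool" where
  "base_strat_ideal sc I J \<longleftrightarrow> (\<exists>e. e * e - e \<in> I
     \<and> J = ksum (ideal_gen sc {e}) I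
     \<and> left_proj sc UNIV I J I
     \<and> right_proj sc UNIV I J I
     \<and> std_based sc {e * a * e | a. True} e (I \<inter> {e * a * e | a. True}))"

definition base_stratified :: "('k::field \<Rightarrow> 'a::ring_1 \<Rightarrow> 'a) \<Rightarrow> nat \<Rightarrow> (nat \<Rightarrow> 'a) \<Rightarrow> bool" where
  "base_stratified sc n es \<longleftrightarrow>
     (\<forall>i\<in>{1..n+1}. base_strat_ideal sc (Jideal sc n es (i - 1)) (Jideal sc n es i))"

end

theory Submission
  imports Defs
begin

text \<open>
  The idempotents \<open>e\<^sub>i = es i\<close> need not lie in \<open>B\<close>, so the proof works with the projection
  \<open>prB\<close> of \<open>A = B \<oplus> A\<^sub>-B\<close> onto \<open>B\<close>. It is right \<open>B\<close>-linear, multiplicative on \<open>A\<^sub>0\<close>, and maps \<open>A\<^sub>0\<close> onto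
  \<open>H = B\<^sub>0\<close>; hence \<open>f = prB e\<^sub>d\<close> is a central idempotent of \<open>H\<close>. Let \<open>I\<close> and \<open>J\<close> be the ideals generated
  by \<open>e\<^sub>0, \<dots>, e\<^sub>d\<^sub>-\<^sub>1\<close> and by \<open>e\<^sub>0, \<dots>, e\<^sub>d\<close>. Since \<open>e\<^sub>k A\<^sub>- \<subseteq> \<Sum>\<^sub>l\<^sub><\<^sub>k A e\<^sub>l\<close>, the ideal \<open>I\<close> is spanned by
  \<open>A e\<^sub>k B\<close> with \<open>k < d\<close>, and \<open>e\<^sub>d y \<in> I\<close> for \<open>y \<in> A\<^sub>-B\<close>, while \<open>e\<^sub>d I \<subseteq> A\<^sub>-B\<close>. So \<open>prB\<close> identifies \<open>e\<^sub>dA/e\<^sub>dI\<close>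
  with \<open>fB\<close> and \<open>e\<^sub>dAe\<^sub>d/(I \<inter> e\<^sub>dAe\<^sub>d)\<close> with the block \<open>fH\<close> of \<open>H\<close>.

  A dual basis \<open>(x\<^sub>i, \<phi>\<^sub>i)\<close> of \<open>A\<close> over \<open>B\<close> yields the right dual basis of \<open>J/I\<close> with elements \<open>x\<^sub>i e\<^sub>d\<close> and forms
  \<open>\<Lambda>\<^sub>i m = \<Sum>\<^sub>j e\<^sub>d \<phi>\<^sub>i(m e\<^sub>j) e\<^sub>j\<close>, and a dual basis \<open>(\<psi>\<^sub>j, y\<^sub>j)\<close> of \<open>B\<close> over \<open>H\<close> then yields the left dual basis with
  elements \<open>e\<^sub>d y\<^sub>j\<close> and forms \<open>m \<mapsto> \<Sum>\<^sub>i x\<^sub>i e\<^sub>d \<psi>\<^sub>j(prB (\<Lambda>\<^sub>i m))\<close>. Working with the \<open>\<Lambda>\<^sub>i\<close> avoids the tensor product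
  \<open>Ae\<^sub>d \<otimes> e\<^sub>dA\<close>.
\<close>

subsection \<open>Standardly based structures on central blocks\<close>

text \<open>The induction runs over the number of elements strictly above \<open>p\<close>:
  everything above a larger \<open>q\<close> is also above \<open>p\<close>, while \<open>q\<close>
  itself drops out. Applied to the reversed order it yields minimal elements.\<close>

lemma poset_upward_induct [consumes 5, case_names step]:
  fixes le :: "'b \<Rightarrow> 'b \<Rightarrow> bool"
  assumes "finite L" and "\<forall>p\<in>L. le p p"
    and antisym: "\<forall>p\<in>L. \<forall>q\<in>L. le p q \<and> le q p \<longrightarrow> p = q"
    and trans: "\<forall>p\<in>L. \<forall>q\<in>L. \<forall>r\<in>L. le p q \<and> le q r \<longrightarrow> le p r"
    and "p \<in> L"
    and step: "\<And>p. p \<in> L \<Longrightarrow> (\<And>q. q \<in> L \<Longrightarrow> le p q \<Longrightarrow> p \<noteq> q \<Longrightarrow> P q) \<Longrightarrow> P p"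
  shows "P p"
  using \<open>p \<in> L\<close>
proof (induction "card {q \<in> L. le p q \<and> p \<noteq> q}" arbitrary: p rule: less_induct)
  case less
  show ?case
  proof (rule step)
    fix q assume q: "q \<in> L" "le p q" "p \<noteq> q"
    have "{r \<in> L. le q r \<and> q \<noteq> r} \<subset> {r \<in> L. le p r \<and> p \<noteq> r}"
    proof (rule psubsetI)
      show "{r \<in> L. le q r \<and> q \<noteq> r} \<subseteq> {r \<in> L. le p r \<and> p \<noteq> r}"
        using q less.prems trans antisym by blast
      show "{r \<in> L. le q r \<and> q \<noteq> r} \<noteq> {r \<in> L. le p r \<and> p \<noteq> r}"
        using q by blast
    qed
    then have "card {r \<in> L. le q r \<and> q \<noteq> r} < card {r \<in> L. le p r \<and> p \<noteq> r}"
      using \<open>finite L\<close> by (intro psubset_card_mono) auto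
    then show "P q" using less.hyps q by blast
  qed (use less.prems in auto)
qed

context vector_space
begin

lemma subspace_ksum: "subspace X \<Longrightarrow> subspace Y \<Longrightarrow> subspace (ksum X Y)"
  unfolding ksum_def by (rule subspace_sums)

text \<open>Works down from the maximal elements: the layers strictly above \<open>p\<close> lie in
  \<open>D\<close> by induction, and \<open>Acomp p\<close> supplies what is left of
  \<open>Age p\<close>.\<close>

lemma layers_generate:
  assumes "finite L" and "\<forall>p\<in>L. le p p"
    and antisym: "\<forall>p\<in>L. \<forall>q\<in>L. le p q \<and> le q p \<longrightarrow> p = q"
    and trans: "\<forall>p\<in>L. \<forall>q\<in>L. \<forall>r\<in>L. le p q \<and> le q r \<longrightarrow> le p r"
    and Age: "\<forall>p\<in>L. Age p \<subseteq> ksum (Acomp p) (span (N \<union> \<Union>{Age q |q. q \<in> L \<and> le p q \<and> p \<noteq> q}))"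
    and "p \<in> L" and "subspace D" and "N \<subseteq> D" and "\<And>q. q \<in> L \<Longrightarrow> le p q \<Longrightarrow> Acomp q \<subseteq> D"
  shows "Age p \<subseteq> D"
  using assms(1-4,6,9)
proof (induction rule: poset_upward_induct)
  case (step p)
  have "Age q \<subseteq> D" if "q \<in> L" "le p q" "p \<noteq> q" for q
  proof (rule step(2)[OF that])
    fix r assume "r \<in> L" "le q r"
    then show "Acomp r \<subseteq> D" using that step(1,3) trans by blast
  qed
  then have "span (N \<union> \<Union>{Age q |q. q \<in> L \<and> le p q \<and> p \<noteq> q}) \<subseteq> D"
    using \<open>subspace D\<close> \<open>N \<subseteq> D\<close> by (intro span_minimal) auto
  moreover have "Acomp p \<subseteq> D" using step assms(2) by blast
  ultimately have "ksum (Acomp p) (span (N \<union> \<Union>{Age q |q. q \<in> L \<and> le p q \<and> p \<noteq> q})) \<subseteq> D"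
    using \<open>subspace D\<close> unfolding ksum_def by (auto intro: subspace_add)
  then show ?case using Age step(1) by blast
qed

text \<open>The sums of elements of complements strictly above \<open>p\<close> form a subspace
  \<open>D\<close> containing each of those complements, so \<open>layers_generate\<close> applies
  to every higher layer. This expansion provides the triangularity used in
  \<open>std_based_corner\<close>.\<close>

lemma layers_components:
  assumes "finite L" and "\<forall>p\<in>L. le p p"
    and antisym: "\<forall>p\<in>L. \<forall>q\<in>L. le p q \<and> le q p \<longrightarrow> p = q"
    and trans: "\<forall>p\<in>L. \<forall>q\<in>L. \<forall>r\<in>L. le p q \<and> le q r \<longrightarrow> le p r"
    and Age: "\<forall>p\<in>L. Age p \<subseteq> ksum (Acomp p) (span (N \<union> \<Union>{Age q |q. q \<in> L \<and> le p q \<and> p \<noteq> q}))"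
    and Acomp: "\<forall>p\<in>L. subspace (Acomp p)" and N: "N \<subseteq> {0}"
    and "p \<in> L" and y: "y \<in> span (N \<union> \<Union>{Age q |q. q \<in> L \<and> le p q \<and> p \<noteq> q})"
  obtains z where "\<And>r. r \<in> L \<Longrightarrow> z r \<in> Acomp r" "\<And>r. \<not> (le p r \<and> p \<noteq> r) \<Longrightarrow> z r = 0"
    "y = (\<Sum>r\<in>L. z r)"
proof -
  define D where "D = {\<Sum>r\<in>L. z r | z. (\<forall>r\<in>L. z r \<in> Acomp r) \<and> (\<forall>r. \<not> (le p r \<and> p \<noteq> r) \<longrightarrow> z r = 0)}"
  have D: "subspace D"
  proof (rule subspaceI)
    show "0 \<in> D" unfolding D_def using Acomp
      by (auto intro!: exI[of _ "\<lambda>_. 0"] simp: subspace_0)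
  next
    fix x y assume "x \<in> D" "y \<in> D"
    then obtain z z' where "x = (\<Sum>r\<in>L. z r)" "\<forall>r\<in>L. z r \<in> Acomp r"
      "\<forall>r. \<not> (le p r \<and> p \<noteq> r) \<longrightarrow> z r = 0" "y = (\<Sum>r\<in>L. z' r)" "\<forall>r\<in>L. z' r \<in> Acomp r"
      "\<forall>r. \<not> (le p r \<and> p \<noteq> r) \<longrightarrow> z' r = 0"
      unfolding D_def by blast
    then show "x + y \<in> D" unfolding D_def using Acomp
      by (auto intro!: exI[of _ "\<lambda>r. z r + z' r"] simp: sum.distrib subspace_add)
  next
    fix c x assume "x \<in> D"
    then obtain z where "x = (\<Sum>r\<in>L. z r)" "\<forall>r\<in>L. z r \<in> Acomp r"
      "\<forall>r. \<not> (le p r \<and> p \<noteq> r) \<longrightarrow> z r = 0"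
      unfolding D_def by blast
    then show "scale c x \<in> D" unfolding D_def using Acomp
      by (auto intro!: exI[of _ "\<lambda>r. scale c (z r)"] simp: scale_sum_right subspace_scale)
  qed
  have AcD: "Acomp q \<subseteq> D" if q: "q \<in> L" "le p q" "p \<noteq> q" for q
  proof
    fix x assume "x \<in> Acomp q"
    then show "x \<in> D" unfolding D_def using q Acomp \<open>finite L\<close>
      by (auto intro!: exI[of _ "\<lambda>r. if r = q then x else 0"] simp: subspace_0)
  qed
  have "Age q \<subseteq> D" if q: "q \<in> L" "le p q" "p \<noteq> q" for q
  proof (rule layers_generate[OF assms(1-4) Age q(1) D])
    show "N \<subseteq> D" using N subspace_0[OF D] by blast
    fix r assume "r \<in> L" "le q r"
    then show "Acomp r \<subseteq> D" using q trans antisym AcD \<open>p \<in> L\<close> by metis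
  qed
  then have "span (N \<union> \<Union>{Age q |q. q \<in> L \<and> le p q \<and> p \<noteq> q}) \<subseteq> D"
    using D N subspace_0[OF D] by (intro span_minimal) auto
  then show thesis using y that unfolding D_def by blast
qed

end

locale k_algebra = vector_space sc for sc :: "'k::field \<Rightarrow> 'a::ring_1 \<Rightarrow> 'a" +
  assumes scale_mult_left: "sc c (a * b) = sc c a * b"
    and scale_mult_right: "sc c (a * b) = a * sc c b"
    and finite_spanning: "\<exists>S. finite S \<and> span S = UNIV"
begin

lemma subspace_left_mult: "subspace S \<Longrightarrow> subspace {x. a * x \<in> S}"
  by (rule subspaceI) (auto simp: subspace_0 distrib_left subspace_add subspace_scale simp flip: scale_mult_right)

lemma subspace_right_mult: "subspace S \<Longrightarrow> subspace {x. x * a \<in> S}"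
  by (rule subspaceI) (auto simp: subspace_0 distrib_right subspace_add subspace_scale simp flip: scale_mult_left)

end

text \<open>An algebra C/N identified, through a homomorphism with kernel N, with the block of H cut out
  by the central idempotent that is the image of the unit u.\<close>

locale central_corner = k_algebra sc for sc :: "'k::field \<Rightarrow> 'a::ring_1 \<Rightarrow> 'a" +
  fixes C N H :: "'a set" and u :: 'a and \<pi> :: "'a \<Rightarrow> 'a"
  assumes C: "subspace C" and C_mult: "\<And>x y. x \<in> C \<Longrightarrow> y \<in> C \<Longrightarrow> x * y \<in> C"
    and u: "u \<in> C" "\<And>y. y \<in> C \<Longrightarrow> u * y = y"
    and \<pi>_H: "\<And>y. y \<in> C \<Longrightarrow> \<pi> y \<in> H"
    and \<pi>_add: "\<And>x y. x \<in> C \<Longrightarrow> y \<in> C \<Longrightarrow> \<pi> (x + y) = \<pi> x + \<pi> y"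
    and \<pi>_scale: "\<And>c y. y \<in> C \<Longrightarrow> \<pi> (sc c y) = sc c (\<pi> y)"
    and \<pi>_mult: "\<And>x y. x \<in> C \<Longrightarrow> y \<in> C \<Longrightarrow> \<pi> (x * y) = \<pi> x * \<pi> y"
    and central: "\<And>h. h \<in> H \<Longrightarrow> \<pi> u * h = h * \<pi> u"
    and \<pi>_onto: "\<And>h. h \<in> H \<Longrightarrow> \<exists>y\<in>C. \<pi> y = \<pi> u * h"
    and N: "N = {y \<in> C. \<pi> y = 0}"
begin

lemma \<pi>_zero: "\<pi> 0 = 0"
  using \<pi>_add[of 0 0] C subspace_0 by auto

lemma \<pi>_uminus: "y \<in> C \<Longrightarrow> \<pi> (- y) = - \<pi> y"
  using \<pi>_add[of y "- y"] \<pi>_zero subspace_neg[OF C] by (simp add: add_eq_0_iff)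

lemma \<pi>_diff: "x \<in> C \<Longrightarrow> y \<in> C \<Longrightarrow> \<pi> (x - y) = \<pi> x - \<pi> y"
  using \<pi>_add[of x "- y"] \<pi>_uminus subspace_neg[OF C] by simp

lemma \<pi>_sum: "(\<And>i. i \<in> S \<Longrightarrow> y i \<in> C) \<Longrightarrow> \<pi> (\<Sum>i\<in>S. y i) = (\<Sum>i\<in>S. \<pi> (y i))"
proof (induction S rule: infinite_finite_induct)
  case (insert x F)
  then show ?case using subspace_sum[OF C, of F y] by (simp add: \<pi>_add)
qed (auto simp: \<pi>_zero)

lemma \<pi>_sum_scale:
  "(\<And>i. i \<in> S \<Longrightarrow> y i \<in> C) \<Longrightarrow> \<pi> (\<Sum>i\<in>S. sc (c i) (y i)) = (\<Sum>i\<in>S. sc (c i) (\<pi> (y i)))"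
  by (subst \<pi>_sum) (auto simp: \<pi>_scale C subspace_scale)

lemma \<pi>_unit: "y \<in> C \<Longrightarrow> \<pi> u * \<pi> y = \<pi> y"
  using \<pi>_mult[of u y] u by simp

lemma subspace_vimage:
  assumes "subspace X" shows "subspace {y \<in> C. \<pi> y \<in> X}"
  using assms C by (auto intro!: subspaceI simp: subspace_0 subspace_add subspace_scale \<pi>_zero \<pi>_add \<pi>_scale)

lemma span_vimage:
  assumes "\<Union>\<A> \<subseteq> H" and stable: "\<And>X x. X \<in> \<A> \<Longrightarrow> x \<in> X \<Longrightarrow> \<pi> u * x \<in> X" and "subspace H"
  shows "span (N \<union> \<Union>((\<lambda>X. {y \<in> C. \<pi> y \<in> X}) ` \<A>)) = {y \<in> C. \<pi> y \<in> span (\<Union>\<A>)}" (is "?S = ?T")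
proof
  have "subspace ?T" by (intro subspace_vimage subspace_span)
  then show "?S \<subseteq> ?T"
    by (intro span_minimal) (auto simp: N span_zero intro: span_base)
  \<comment> \<open>Quantifying over all preimages \<open>y\<close> lets the induction subtract a
    lift \<open>w\<close> of \<open>\<pi> u * x\<close>; for \<open>z = 0\<close> the preimages form
    \<open>N\<close>. Stability of \<open>X\<close> puts \<open>w\<close> into the preimage of
    \<open>X\<close>.\<close>
  have "\<forall>y\<in>C. \<pi> y = \<pi> u * z \<longrightarrow> y \<in> ?S" if "z \<in> span (\<Union>\<A>)" for z
  using that proof (induction rule: span_induct_alt)
    case base
    then show ?case by (auto simp: N intro!: span_base)
  next
    case (step c x z)
    obtain X where X: "X \<in> \<A>" "x \<in> X" using step(1) by blast
    have "x \<in> H" using X assms(1) by blast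
    then obtain w where w: "w \<in> C" "\<pi> w = \<pi> u * x" using \<pi>_onto by blast
    have wS: "w \<in> ?S" using w X stable[OF X] by (intro span_base) auto
    show ?case
    proof (intro ballI impI)
      fix y assume y: "y \<in> C" "\<pi> y = \<pi> u * (sc c x + z)"
      have wC: "sc c w \<in> C" using w C subspace_scale by blast
      have "\<pi> (y - sc c w) = \<pi> u * z"
        using y w wC by (simp add: \<pi>_diff \<pi>_scale distrib_left scale_mult_right)
      moreover have "y - sc c w \<in> C" using y wC C subspace_diff by blast
      ultimately have "y - sc c w \<in> ?S" using step(2) by blast
      then have "(y - sc c w) + sc c w \<in> ?S" using wS span_add span_scale by blast
      then show "y \<in> ?S" by simp
    qed
  qed
  then show "?T \<subseteq> ?S" using \<pi>_unit by auto
qed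

lemma layer_tensor_empty:
  assumes "G \<subseteq> T" and "0 \<in> T"
  shows "layer_tensor sc C u N G T"
  unfolding layer_tensor_def
  by (rule exI[of _ 0], rule exI[of _ 0], rule exI[of _ "\<lambda>_ _. 0"], rule exI[of _ "\<lambda>_ _ _. 0"],
      rule exI[of _ "\<lambda>_ _ _. 0"]) (use assms in auto)

text \<open>A central element acts on \<open>W \<otimes> W'\<close> both as \<open>\<rho> \<otimes> 1\<close> and as \<open>1 \<otimes> \<rho>'\<close>, hence as a scalar;
  being idempotent it kills the layer or fixes it.\<close>

lemma layer_tensor_vimage:
  assumes lay: "layer_tensor sc H v {0} G T" and H: "subspace H" and T: "subspace T" and "G \<subseteq> H"
    and TH: "\<forall>a\<in>H. \<forall>y\<in>T. a * y \<in> T" and GH: "\<forall>a\<in>H. \<forall>y\<in>G. a * y \<in> G"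
  shows "layer_tensor sc C u N {y \<in> C. \<pi> y \<in> G} {y \<in> C. \<pi> y \<in> T}"
  using lay[unfolded layer_tensor_def]
proof (elim exE conjE, goal_cases)
  case (1 m m' x \<rho> \<rho>')
  note mult = 1(1) and add = 1(3) and scl = 1(4) and nul = 1(5)
    and mult' = 1(6) and add' = 1(8) and scl' = 1(9) and nul' = 1(10)
    and xG = 1(11) and indep = 1(12)[rule_format] and gen = 1(13) and left = 1(14) and right = 1(15)
  define f where "f = \<pi> u"
  have fH: "f \<in> H" unfolding f_def using \<pi>_H u by blast
  have ff: "f * f = f" unfolding f_def using \<pi>_unit u by blast
  have fT: "f * t \<in> T" if "t \<in> T" for t using TH fH that by blast
  \<comment> \<open>Both sides are coefficients of \<open>x k l\<close>, in the expansion of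
    \<open>f * x i j\<close> by \<open>\<rho>\<close> and of \<open>x i j * f\<close> by
    \<open>\<rho>'\<close>; independence modulo \<open>T\<close> equates them.\<close>
  have coeff: "\<rho> f k i * (if l = j then 1 else 0) = (if k = i then 1 else 0) * \<rho>' f j l"
    if i: "i < m" "k < m" and j: "j < m'" "l < m'" for i j k l
  proof -
    have comm: "f * x i j = x i j * f" using central xG i j \<open>G \<subseteq> H\<close> f_def by blast
    have "(\<Sum>k<m. sc (\<rho> f k i) (x k j)) - (\<Sum>l<m'. sc (\<rho>' f j l) (x i l))
      = (x i j * f - (\<Sum>l<m'. sc (\<rho>' f j l) (x i l))) - (f * x i j - (\<Sum>k<m. sc (\<rho> f k i) (x k j)))"
      using comm by simp
    also have "\<dots> \<in> T" using left right fH i j T subspace_diff by blast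
    finally have "(\<Sum>k<m. sc (\<rho> f k i) (x k j)) - (\<Sum>l<m'. sc (\<rho>' f j l) (x i l)) \<in> T" .
    moreover have "(\<Sum>k<m. \<Sum>l<m'. sc (\<rho> f k i * (if l = j then 1 else 0)) (x k l)) = (\<Sum>k<m. sc (\<rho> f k i) (x k j))"
      using j by (simp add: if_distrib if_distribR cong: if_cong)
    moreover have "(\<Sum>k<m. \<Sum>l<m'. sc ((if k = i then 1 else 0) * \<rho>' f j l) (x k l)) = (\<Sum>l<m'. sc (\<rho>' f j l) (x i l))"
      using i by (subst sum.swap) (simp add: if_distrib if_distribR cong: if_cong)
    ultimately have "(\<Sum>k<m. \<Sum>l<m'. sc (\<rho> f k i * (if l = j then 1 else 0) - (if k = i then 1 else 0) * \<rho>' f j l) (x k l)) \<in> T"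
      by (simp only: scale_left_diff_distrib sum_subtractf)
    from indep[OF this i(2) j(2)] show ?thesis by simp
  qed
  show ?thesis
  \<comment> \<open>By \<open>coeff\<close> one diagonal entry equal to 1 makes \<open>f\<close> act
    as the identity on the whole layer. The other case, which includes empty bases, gives the zero
    layer.\<close>
  proof (cases "\<exists>i<m. \<exists>j<m'. \<rho> f i i = 1")
    case False
    have "{y \<in> C. \<pi> y \<in> G} \<subseteq> {y \<in> C. \<pi> y \<in> T}"
    proof (intro subsetI CollectI conjI; clarify)
      fix y assume y: "y \<in> C" "\<pi> y \<in> G"
      have zero: "f * x i j \<in> T" if "i < m" "j < m'" for i j
      proof -
        have off: "\<rho> f k i = 0" if "k \<noteq> i" "k < m" for k
          using coeff[of i k j j] that \<open>i < m\<close> \<open>j < m'\<close> by auto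
        have "\<rho> f i i = (\<Sum>l<m. \<rho> f i l * \<rho> f l i)" using mult fH ff \<open>i < m\<close> by metis
        also have "\<dots> = (\<Sum>l<m. if l = i then \<rho> f i i * \<rho> f i i else 0)"
          by (rule sum.cong) (auto simp: off)
        also have "\<dots> = \<rho> f i i * \<rho> f i i" using \<open>i < m\<close> by simp
        finally have "\<rho> f i i = 0 \<or> \<rho> f i i = 1" by simp
        with False that have "\<rho> f i i = 0" by blast
        with off have "\<rho> f k i = 0" if "k < m" for k using that by (cases "k = i") auto
        then have "(\<Sum>k<m. sc (\<rho> f k i) (x k j)) = 0" by (intro sum.neutral) auto
        then show ?thesis using left fH that by (metis diff_zero)
      qed
      obtain c where c: "\<pi> y - (\<Sum>i<m. \<Sum>j<m'. sc (c i j) (x i j)) \<in> T" using gen y by blast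
      have "f * (\<pi> y - (\<Sum>i<m. \<Sum>j<m'. sc (c i j) (x i j))) \<in> T" using c fT by blast
      then have 1: "\<pi> y - (\<Sum>i<m. \<Sum>j<m'. sc (c i j) (f * x i j)) \<in> T"
        using \<pi>_unit y by (simp add: f_def right_diff_distrib sum_distrib_left scale_mult_right)
      moreover have "(\<Sum>i<m. \<Sum>j<m'. sc (c i j) (f * x i j)) \<in> T"
        using zero T by (intro subspace_sum subspace_scale) auto
      ultimately show "\<pi> y \<in> T" using T subspace_add by fastforce
    qed
    then show ?thesis
      by (rule layer_tensor_empty) (use subspace_0[OF C] subspace_0[OF T] \<pi>_zero in auto)
  next
    case True
    then obtain i0 j0 where i0: "i0 < m" "j0 < m'" "\<rho> f i0 i0 = 1" by blast
    have r': "\<rho>' f j l = (if j = l then 1 else 0)" if "j < m'" "l < m'" for j l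
      using coeff[of i0 i0 j l] i0 that by auto
    have r: "\<rho> f k i = (if k = i then 1 else 0)" if "k < m" "i < m" for k i
      using coeff[of i k j0 j0] r'[of j0 j0] i0 that by auto
    have x_fixed: "f * x i j - x i j \<in> T" if "i < m" "j < m'" for i j
    proof -
      have "(\<Sum>k<m. sc (\<rho> f k i) (x k j)) = (\<Sum>k<m. if k = i then x i j else 0)"
        using that by (intro sum.cong) (auto simp: r)
      also have "\<dots> = x i j" using that by simp
      finally show ?thesis using left fH that by metis
    qed
    have fixsum: "(\<Sum>i<m. \<Sum>j<m'. sc (c i j) (f * x i j)) - (\<Sum>i<m. \<Sum>j<m'. sc (c i j) (x i j)) \<in> T" for c
    proof -
      have "(\<Sum>i<m. \<Sum>j<m'. sc (c i j) (f * x i j - x i j)) \<in> T"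
        using x_fixed T by (intro subspace_sum subspace_scale) auto
      then show ?thesis by (simp add: scale_right_diff_distrib sum_subtractf)
    qed
    \<comment> \<open>The new basis lifts \<open>f * x i j\<close>, which agrees with
      \<open>x i j\<close> modulo \<open>T\<close>; the modules W and W' stay the same, with
      \<open>C\<close> acting through \<open>\<pi>\<close>.\<close>
    have "\<forall>i j. \<exists>w. i < m \<and> j < m' \<longrightarrow> w \<in> C \<and> \<pi> w = f * x i j"
      using \<pi>_onto xG \<open>G \<subseteq> H\<close> f_def by blast
    then obtain w where w: "\<And>i j. i < m \<Longrightarrow> j < m' \<Longrightarrow> w i j \<in> C"
      "\<And>i j. i < m \<Longrightarrow> j < m' \<Longrightarrow> \<pi> (w i j) = f * x i j" by metis
    have wsumC: "(\<Sum>i<m. \<Sum>j<m'. sc (c i j) (w i j)) \<in> C" for c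
      using w C by (intro subspace_sum subspace_scale) auto
    have wsum: "\<pi> (\<Sum>i<m. \<Sum>j<m'. sc (c i j) (w i j)) = (\<Sum>i<m. \<Sum>j<m'. sc (c i j) (f * x i j))" for c
    proof -
      have "\<pi> (\<Sum>i<m. \<Sum>j<m'. sc (c i j) (w i j)) = (\<Sum>i<m. \<pi> (\<Sum>j<m'. sc (c i j) (w i j)))"
        using w C by (intro \<pi>_sum subspace_sum subspace_scale) auto
      also have "\<dots> = (\<Sum>i<m. \<Sum>j<m'. sc (c i j) (f * x i j))"
        using w by (intro sum.cong refl) (subst \<pi>_sum_scale; simp)
      finally show ?thesis .
    qed
    show ?thesis
      unfolding layer_tensor_def
    proof (intro exI conjI)
      show "\<forall>a\<in>C. \<forall>b\<in>C. \<forall>k<m. \<forall>i<m. \<rho> (\<pi> (a * b)) k i = (\<Sum>l<m. \<rho> (\<pi> a) k l * \<rho> (\<pi> b) l i)"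
        using mult by (simp add: \<pi>_mult \<pi>_H)
      show "\<forall>k<m. \<forall>i<m. \<rho> (\<pi> u) k i = (if k = i then 1 else 0)" using r f_def by simp
      show "\<forall>a\<in>C. \<forall>b\<in>C. \<forall>k<m. \<forall>i<m. \<rho> (\<pi> (a + b)) k i = \<rho> (\<pi> a) k i + \<rho> (\<pi> b) k i"
        using add by (simp add: \<pi>_add \<pi>_H)
      show "\<forall>c. \<forall>a\<in>C. \<forall>k<m. \<forall>i<m. \<rho> (\<pi> (sc c a)) k i = c * \<rho> (\<pi> a) k i"
        using scl by (simp add: \<pi>_scale \<pi>_H)
      show "\<forall>a\<in>N. \<forall>k<m. \<forall>i<m. \<rho> (\<pi> a) k i = 0" using nul N by simp
      show "\<forall>a\<in>C. \<forall>b\<in>C. \<forall>j<m'. \<forall>l<m'. \<rho>' (\<pi> (a * b)) j l = (\<Sum>t<m'. \<rho>' (\<pi> a) j t * \<rho>' (\<pi> b) t l)"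
        using mult' by (simp add: \<pi>_mult \<pi>_H)
      show "\<forall>j<m'. \<forall>l<m'. \<rho>' (\<pi> u) j l = (if j = l then 1 else 0)" using r' f_def by simp
      show "\<forall>a\<in>C. \<forall>b\<in>C. \<forall>j<m'. \<forall>l<m'. \<rho>' (\<pi> (a + b)) j l = \<rho>' (\<pi> a) j l + \<rho>' (\<pi> b) j l"
        using add' by (simp add: \<pi>_add \<pi>_H)
      show "\<forall>c. \<forall>a\<in>C. \<forall>j<m'. \<forall>l<m'. \<rho>' (\<pi> (sc c a)) j l = c * \<rho>' (\<pi> a) j l"
        using scl' by (simp add: \<pi>_scale \<pi>_H)
      show "\<forall>a\<in>N. \<forall>j<m'. \<forall>l<m'. \<rho>' (\<pi> a) j l = 0" using nul' N by simp
      show "\<forall>i<m. \<forall>j<m'. w i j \<in> {y \<in> C. \<pi> y \<in> G}"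
        using w GH fH xG by simp
      show "\<forall>c. (\<Sum>i<m. \<Sum>j<m'. sc (c i j) (w i j)) \<in> {y \<in> C. \<pi> y \<in> T}
         \<longrightarrow> (\<forall>i<m. \<forall>j<m'. c i j = 0)"
      proof (intro allI impI)
        fix c i j assume "(\<Sum>i<m. \<Sum>j<m'. sc (c i j) (w i j)) \<in> {y \<in> C. \<pi> y \<in> T}" and ij: "i < m" "j < m'"
        then have "(\<Sum>i<m. \<Sum>j<m'. sc (c i j) (f * x i j)) \<in> T" by (simp add: wsum)
        from subspace_diff[OF T this fixsum[of c]] have "(\<Sum>i<m. \<Sum>j<m'. sc (c i j) (x i j)) \<in> T" by simp
        from indep[OF this ij] show "c i j = 0" .
      qed
      show "\<forall>y\<in>{y \<in> C. \<pi> y \<in> G}. \<exists>c. y - (\<Sum>i<m. \<Sum>j<m'. sc (c i j) (w i j)) \<in> {y \<in> C. \<pi> y \<in> T}"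
      proof
        fix y assume y: "y \<in> {y \<in> C. \<pi> y \<in> G}"
        then obtain c where c: "\<pi> y - (\<Sum>i<m. \<Sum>j<m'. sc (c i j) (x i j)) \<in> T" using gen by blast
        from subspace_diff[OF T this fixsum[of c]]
        have "\<pi> y - (\<Sum>i<m. \<Sum>j<m'. sc (c i j) (f * x i j)) \<in> T" by simp
        then have "y - (\<Sum>i<m. \<Sum>j<m'. sc (c i j) (w i j)) \<in> {y \<in> C. \<pi> y \<in> T}"
          using y wsumC subspace_diff[OF C] by (simp add: \<pi>_diff wsum)
        then show "\<exists>c. y - (\<Sum>i<m. \<Sum>j<m'. sc (c i j) (w i j)) \<in> {y \<in> C. \<pi> y \<in> T}" by blast
      qed
      show "\<forall>a\<in>C. \<forall>i<m. \<forall>j<m'. a * w i j - (\<Sum>k<m. sc (\<rho> (\<pi> a) k i) (w k j)) \<in> {y \<in> C. \<pi> y \<in> T}"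
      proof (intro ballI allI impI)
        fix a i j assume a: "a \<in> C" and ij: "i < m" "j < m'"
        have sC: "(\<Sum>k<m. sc (\<rho> (\<pi> a) k i) (w k j)) \<in> C"
          using w ij C by (intro subspace_sum subspace_scale) auto
        have "f * (\<pi> a * x i j - (\<Sum>k<m. sc (\<rho> (\<pi> a) k i) (x k j))) \<in> T"
          using left a ij \<pi>_H fT by blast
        moreover have "f * (\<pi> a * x i j) = \<pi> a * (f * x i j)"
          using central[OF \<pi>_H[OF a]] f_def by (metis mult.assoc)
        moreover have "\<pi> (\<Sum>k<m. sc (\<rho> (\<pi> a) k i) (w k j)) = (\<Sum>k<m. sc (\<rho> (\<pi> a) k i) (f * x k j))"
          using w ij by (subst \<pi>_sum_scale) auto
        ultimately show "a * w i j - (\<Sum>k<m. sc (\<rho> (\<pi> a) k i) (w k j)) \<in> {y \<in> C. \<pi> y \<in> T}"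
          using a w ij sC subspace_diff[OF C] C_mult
          by (simp add: \<pi>_diff \<pi>_mult right_diff_distrib sum_distrib_left scale_mult_right)
      qed
      show "\<forall>a\<in>C. \<forall>i<m. \<forall>j<m'. w i j * a - (\<Sum>l<m'. sc (\<rho>' (\<pi> a) j l) (w i l)) \<in> {y \<in> C. \<pi> y \<in> T}"
      proof (intro ballI allI impI)
        fix a i j assume a: "a \<in> C" and ij: "i < m" "j < m'"
        have sC: "(\<Sum>l<m'. sc (\<rho>' (\<pi> a) j l) (w i l)) \<in> C"
          using w ij C by (intro subspace_sum subspace_scale) auto
        have "f * (x i j * \<pi> a - (\<Sum>l<m'. sc (\<rho>' (\<pi> a) j l) (x i l))) \<in> T"
          using right a ij \<pi>_H fT by blast
        moreover have "\<pi> (\<Sum>l<m'. sc (\<rho>' (\<pi> a) j l) (w i l)) = (\<Sum>l<m'. sc (\<rho>' (\<pi> a) j l) (f * x i l))"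
          using w ij by (subst \<pi>_sum_scale) auto
        ultimately show "w i j * a - (\<Sum>l<m'. sc (\<rho>' (\<pi> a) j l) (w i l)) \<in> {y \<in> C. \<pi> y \<in> T}"
          using a w ij sC subspace_diff[OF C] C_mult
          by (simp add: \<pi>_diff \<pi>_mult right_diff_distrib sum_distrib_left scale_mult_right mult.assoc)
      qed
    qed
  qed
qed

text \<open>With \<open>f = \<pi> u\<close>, the complements of the block consist of \<open>f a\<close> for those \<open>a\<close> in \<open>Acomp p\<close> that \<open>f\<close>
  fixes modulo \<open>Agt p\<close>: all of \<open>f * Acomp p\<close> could meet \<open>f * Agt p\<close> nontrivially.\<close>

lemma std_based_corner:
  assumes "std_based sc H v {0}"
  shows "std_based sc C u N"
  using assms[unfolded std_based_def Let_def]
proof (elim exE conjE, goal_cases)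
  case (1 L le Age Acomp)
  note finL = 1(1) and po = 1(1-4) and Age = 1(5) and anti = 1(6) and Acomp = 1(7)
    and gen = 1(8) and direct = 1(9) and lay = 1(10)
  define f where "f = \<pi> u"
  define Agt where "Agt p = span ({0} \<union> \<Union>{Age q |q. q \<in> L \<and> le p q \<and> p \<noteq> q})" for p
  have H: "subspace H" using gen by (metis subspace_span)
  have fH: "f \<in> H" unfolding f_def using \<pi>_H u by blast
  have AgeH: "\<And>p x. p \<in> L \<Longrightarrow> x \<in> Age p \<Longrightarrow> x \<in> H"
    and Age_ideal: "\<And>p h x. p \<in> L \<Longrightarrow> h \<in> H \<Longrightarrow> x \<in> Age p \<Longrightarrow> h * x \<in> Age p"
    and Age_ideal_right: "\<And>p h x. p \<in> L \<Longrightarrow> h \<in> H \<Longrightarrow> x \<in> Age p \<Longrightarrow> x * h \<in> Age p"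
    using Age by (auto simp only: subset_iff)
  have Acomp_Age: "\<And>p x. p \<in> L \<Longrightarrow> x \<in> Acomp p \<Longrightarrow> x \<in> Age p"
    and Acomp_sub: "\<And>p. p \<in> L \<Longrightarrow> subspace (Acomp p)"
    using Acomp by (auto simp only: subset_iff)
  have AgtH: "Agt p \<subseteq> Age p" if "p \<in> L" for p
    unfolding Agt_def using anti Age that by (intro span_minimal) (auto simp: subspace_0)
  have Agt_ideal: "a * y \<in> Agt p" if "a \<in> H" "y \<in> Agt p" for a y p
  proof -
    have "Agt p \<subseteq> {y. a * y \<in> Agt p}"
      unfolding Agt_def using Age \<open>a \<in> H\<close>
      by (intro span_minimal subspace_left_mult subspace_span) (auto simp: span_zero intro!: span_base)
    then show ?thesis using that by blast
  qed
  have split: "Age p = ksum (Acomp p) (Agt p)" if "p \<in> L" for p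
    using Acomp that unfolding Agt_def by blast
  define Age' where "Age' p = {y \<in> C. \<pi> y \<in> Age p}" for p
  define Acomp' where "Acomp' p = {y \<in> C. \<exists>a\<in>Acomp p. f * a - a \<in> Agt p \<and> \<pi> y = f * a}" for p
  have Age': "subspace (Age' p)" if "p \<in> L" for p
    unfolding Age'_def using that Age by (intro subspace_vimage) blast
  have NAge': "N \<subseteq> Age' p" if "p \<in> L" for p
    using that Age unfolding Age'_def N by (auto simp: subspace_0)
  have Agt': "span (N \<union> \<Union>{Age' q |q. q \<in> L \<and> le p q \<and> p \<noteq> q}) = {y \<in> C. \<pi> y \<in> Agt p}" for p
  proof -
    have "{Age' q |q. q \<in> L \<and> le p q \<and> p \<noteq> q}
      = (\<lambda>X. {y \<in> C. \<pi> y \<in> X}) ` {Age q |q. q \<in> L \<and> le p q \<and> p \<noteq> q}"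
      unfolding Age'_def by blast
    moreover have "Agt p = span (\<Union>{Age q |q. q \<in> L \<and> le p q \<and> p \<noteq> q})"
      unfolding Agt_def by (simp add: span_insert_0)
    moreover have "\<pi> u * x \<in> X" if "X \<in> {Age q |q. q \<in> L \<and> le p q \<and> p \<noteq> q}" "x \<in> X" for X x
      using that Age_ideal fH unfolding f_def by blast
    ultimately show ?thesis
      using Age by (simp only:) (rule span_vimage, use H in auto)
  qed
  have Acomp': "subspace (Acomp' p)" if "p \<in> L" for p
  proof (rule subspaceI)
    have sub: "subspace (Acomp p)" "subspace (Agt p)" using that Acomp unfolding Agt_def by auto
    show "0 \<in> Acomp' p" unfolding Acomp'_def
      using subspace_0[OF C] \<pi>_zero sub by (auto intro!: bexI[of _ 0] simp: subspace_0)
    fix x y c assume "x \<in> Acomp' p"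
    then obtain a where a: "x \<in> C" "a \<in> Acomp p" "f * a - a \<in> Agt p" "\<pi> x = f * a"
      unfolding Acomp'_def by blast
    have "f * sc c a - sc c a \<in> Agt p"
      using subspace_scale[OF sub(2) a(3), of c] by (simp add: scale_right_diff_distrib scale_mult_right)
    then show "sc c x \<in> Acomp' p" unfolding Acomp'_def using a sub C
      by (auto simp: subspace_scale \<pi>_scale scale_mult_right intro!: bexI[of _ "sc c a"])
    assume "y \<in> Acomp' p"
    then obtain b where b: "y \<in> C" "b \<in> Acomp p" "f * b - b \<in> Agt p" "\<pi> y = f * b"
      unfolding Acomp'_def by blast
    have "f * (a + b) - (a + b) \<in> Agt p"
      using subspace_add[OF sub(2) a(3) b(3)] by (simp add: distrib_left algebra_simps)
    then show "x + y \<in> Acomp' p" unfolding Acomp'_def using a b sub C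
      by (auto simp: subspace_add \<pi>_add distrib_left intro!: bexI[of _ "a + b"])
  qed
  have NAcomp': "N \<subseteq> Acomp' p" if "p \<in> L" for p
    using that Acomp unfolding Acomp'_def N Agt_def
    by (auto simp: subspace_0 span_zero intro!: bexI[of _ 0])
  have Acomp'_Age': "Acomp' p \<subseteq> Age' p" if "p \<in> L" for p
  proof
    fix y assume "y \<in> Acomp' p"
    then obtain a where a: "y \<in> C" "a \<in> Acomp p" "\<pi> y = f * a" unfolding Acomp'_def by blast
    then have "f * a \<in> Age p" using Age_ideal[OF that fH] Acomp_Age[OF that] by simp
    then show "y \<in> Age' p" using a unfolding Age'_def by simp
  qed
  have sum': "ksum (Acomp' p) {y \<in> C. \<pi> y \<in> Agt p} = Age' p" if p: "p \<in> L" for p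
  proof
    show "ksum (Acomp' p) {y \<in> C. \<pi> y \<in> Agt p} \<subseteq> Age' p"
      unfolding ksum_def using Acomp'_Age'[OF p] AgtH[OF p] subspace_add[OF Age'[OF p]]
      by (auto simp: Age'_def subset_iff)
    show "Age' p \<subseteq> ksum (Acomp' p) {y \<in> C. \<pi> y \<in> Agt p}"
    proof
      fix y assume y: "y \<in> Age' p"
      then have yC: "y \<in> C" "\<pi> y \<in> Age p" unfolding Age'_def by auto
      then obtain a g where ag: "a \<in> Acomp p" "g \<in> Agt p" "\<pi> y = a + g"
        using split[OF p] unfolding ksum_def by blast
      have faH: "a \<in> H" using AgeH[OF p Acomp_Age[OF p ag(1)]] .
      have "f * a + f * g = a + g" using \<pi>_unit[OF yC(1)] ag(3) f_def by (metis distrib_left)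
      \<comment> \<open>Since \<open>f\<close> fixes \<open>\<pi> y\<close>, the amount by which
        \<open>f\<close> moves \<open>a\<close> is minus that for \<open>g\<close>, hence lies in
        \<open>Agt p\<close>. This is the condition for a lift of \<open>f * a\<close> to belong to
        \<open>Acomp' p\<close>.\<close>
      then have "f * a - a = g - f * g" by (simp add: algebra_simps)
      moreover have "g - f * g \<in> Agt p"
        using ag(2) Agt_ideal[OF fH ag(2)] subspace_diff[of "Agt p"] unfolding Agt_def by auto
      ultimately have fa: "f * a - a \<in> Agt p" by simp
      obtain w where w: "w \<in> C" "\<pi> w = f * a" using \<pi>_onto[OF faH] f_def by blast
      then have "w \<in> Acomp' p" using ag fa unfolding Acomp'_def by blast
      moreover have "\<pi> (y - w) = f * g"
        using w yC ag(3) \<open>f * a + f * g = a + g\<close> by (simp add: \<pi>_diff algebra_simps)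
      then have "y - w \<in> {y \<in> C. \<pi> y \<in> Agt p}"
        using Agt_ideal[OF fH ag(2)] w yC subspace_diff[OF C] by auto
      moreover have "y = w + (y - w)" by simp
      ultimately show "y \<in> ksum (Acomp' p) {y \<in> C. \<pi> y \<in> Agt p}"
        unfolding ksum_def by blast
    qed
  qed
  \<comment> \<open>The two memberships in \<open>Agt p\<close> put \<open>a\<close> itself there,
    and \<open>Agt p\<close> meets \<open>Acomp p\<close> only in 0.\<close>
  have zero_if: "a = 0" if "p \<in> L" "a \<in> Acomp p" "f * a - a \<in> Agt p" "f * a \<in> Agt p" for p a
  proof -
    have "f * a - (f * a - a) \<in> Agt p"
      using that subspace_diff[of "Agt p"] unfolding Agt_def by blast
    then show ?thesis using that Acomp unfolding Agt_def by auto
  qed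
  have int': "Acomp' p \<inter> {y \<in> C. \<pi> y \<in> Agt p} = N" if p: "p \<in> L" for p
  proof
    show "Acomp' p \<inter> {y \<in> C. \<pi> y \<in> Agt p} \<subseteq> N"
      unfolding Acomp'_def N using zero_if[OF p] by fastforce
    show "N \<subseteq> Acomp' p \<inter> {y \<in> C. \<pi> y \<in> Agt p}"
      using NAcomp'[OF p] unfolding N Agt_def by (auto simp: span_zero)
  qed
  have gen': "span (N \<union> (\<Union>p\<in>L. Acomp' p)) = C"
  proof
    show "span (N \<union> (\<Union>p\<in>L. Acomp' p)) \<subseteq> C"
      using C by (intro span_minimal) (auto simp: N Acomp'_def)
    have sub: "Age' p \<subseteq> span (N \<union> (\<Union>p\<in>L. Acomp' p))" if "p \<in> L" for p
      using po _ that
    proof (rule layers_generate[where Acomp = Acomp' and N = N])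
      show "\<forall>p\<in>L. Age' p \<subseteq> ksum (Acomp' p) (span (N \<union> \<Union>{Age' q |q. q \<in> L \<and> le p q \<and> p \<noteq> q}))"
        using sum' Agt' by simp
    qed (auto intro: span_base)
    \<comment> \<open>\<open>span_vimage\<close> asks for sets stable under \<open>f\<close>, which
      the ideals \<open>Age p\<close> are and the complements may not be; so \<open>C\<close> is
      first generated by layers.\<close>
    have "H = span (\<Union>p\<in>L. Age p)"
    proof
      have "H = span ({0} \<union> (\<Union>p\<in>L. Acomp p))" using gen by simp
      also have "\<dots> \<subseteq> span (\<Union>p\<in>L. Age p)"
        using Acomp_Age by (intro span_minimal) (auto simp: span_zero intro!: span_base)
      finally show "H \<subseteq> span (\<Union>p\<in>L. Age p)" .
      show "span (\<Union>p\<in>L. Age p) \<subseteq> H" using Age H by (intro span_minimal) auto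
    qed
    moreover have "span (N \<union> \<Union>((\<lambda>X. {y \<in> C. \<pi> y \<in> X}) ` (Age ` L))) = {y \<in> C. \<pi> y \<in> span (\<Union>(Age ` L))}"
      by (rule span_vimage) (use Age H fH f_def in auto)
    ultimately have "C \<subseteq> span (N \<union> \<Union>(Age' ` L))"
      using \<pi>_H unfolding Age'_def by (auto simp: image_image)
    also have "\<dots> \<subseteq> span (N \<union> (\<Union>p\<in>L. Acomp' p))"
      using sub by (intro span_minimal) (auto intro: span_base)
    finally show "C \<subseteq> span (N \<union> (\<Union>p\<in>L. Acomp' p))" .
  qed
  have direct': "\<forall>p\<in>L. y p \<in> N" if yA: "\<forall>p\<in>L. y p \<in> Acomp' p" and yN: "(\<Sum>p\<in>L. y p) \<in> N" for y
  proof (rule ccontr)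
    \<comment> \<open>Triangularity: take a minimal \<open>p\<close> with nonzero image. The image
      of \<open>y q\<close> is \<open>a q\<close> plus components strictly above \<open>q\<close>,
      so the total component at \<open>p\<close> is \<open>a p\<close> alone, and directness in
      \<open>H\<close> makes it zero.\<close>
    define S where "S = {p \<in> L. \<pi> (y p) \<noteq> 0}"
    have yC: "y p \<in> C" if "p \<in> L" for p using yA that unfolding Acomp'_def by blast
    assume "\<not> ?thesis"
    then have "S \<noteq> {}" unfolding S_def N using yC by blast
    moreover have "finite S" unfolding S_def using finL by simp
    ultimately obtain p where pS: "p \<in> S" and min: "\<And>q. q \<in> S \<Longrightarrow> q \<noteq> p \<Longrightarrow> \<not> le q p"
    proof -
      have "\<exists>p\<in>S. \<forall>q\<in>S. q \<noteq> p \<longrightarrow> \<not> le q p"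
      proof (rule ccontr)
        assume none: "\<not> ?thesis"
        obtain p0 where "p0 \<in> S" using \<open>S \<noteq> {}\<close> by blast
        have "p \<notin> S" if "p \<in> L" for p
        \<comment> \<open>Induction in the reversed order: without a minimal element,
          \<open>S\<close> empties from the bottom.\<close>
        proof (rule poset_upward_induct[where L = L and le = "\<lambda>a b. le b a" and P = "\<lambda>p. p \<notin> S", OF finL _ _ _ that])
          fix p assume "p \<in> L" "\<And>q. q \<in> L \<Longrightarrow> le q p \<Longrightarrow> p \<noteq> q \<Longrightarrow> q \<notin> S"
          then show "p \<notin> S" using none unfolding S_def by blast
        qed (use po in blast)+
        then show False using \<open>p0 \<in> S\<close> unfolding S_def by blast
      qed
      then show thesis using that by blast
    qed
    have "\<forall>q\<in>L. \<exists>z a. a \<in> Acomp q \<and> f * a - a \<in> Agt q \<and> \<pi> (y q) = f * a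
        \<and> (\<forall>r\<in>L. z r \<in> Acomp r) \<and> (\<forall>r. \<not> le q r \<longrightarrow> z r = 0) \<and> z q = a \<and> \<pi> (y q) = (\<Sum>r\<in>L. z r)"
    proof
      fix q assume q: "q \<in> L"
      obtain a where a: "a \<in> Acomp q" "f * a - a \<in> Agt q" "\<pi> (y q) = f * a"
        using yA q unfolding Acomp'_def by blast
      obtain z where z: "\<And>r. r \<in> L \<Longrightarrow> z r \<in> Acomp r" "\<And>r. \<not> (le q r \<and> q \<noteq> r) \<Longrightarrow> z r = 0"
        "f * a - a = (\<Sum>r\<in>L. z r)"
      proof (rule layers_components[OF po _ _ _ q])
        show "\<forall>p\<in>L. Age p \<subseteq> ksum (Acomp p) (span ({0} \<union> \<Union>{Age q |q. q \<in> L \<and> le p q \<and> p \<noteq> q}))"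
          using split Agt_def by simp
        show "f * a - a \<in> span ({0} \<union> \<Union>{Age qa |qa. qa \<in> L \<and> le q qa \<and> q \<noteq> qa})"
          using a Agt_def by simp
      qed (use Acomp in auto)
      have "(\<Sum>r\<in>L. (z(q := a)) r) = (\<Sum>r\<in>L. z r + (if r = q then a else 0))"
        using z(2)[of q] by (intro sum.cong) auto
      also have "\<dots> = \<pi> (y q)" using z(3) a(3) finL q by (simp add: sum.distrib flip: z(3))
      finally have "\<pi> (y q) = (\<Sum>r\<in>L. (z(q := a)) r)" by simp
      then show "\<exists>z a. a \<in> Acomp q \<and> f * a - a \<in> Agt q \<and> \<pi> (y q) = f * a
        \<and> (\<forall>r\<in>L. z r \<in> Acomp r) \<and> (\<forall>r. \<not> le q r \<longrightarrow> z r = 0) \<and> z q = a \<and> \<pi> (y q) = (\<Sum>r\<in>L. z r)"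
        using a z(1,2) po(2) q by (intro exI[of _ "z(q := a)"] exI[of _ a]) auto
    qed
    from bchoice[OF this] obtain z where "\<forall>q\<in>L. \<exists>a. a \<in> Acomp q \<and> f * a - a \<in> Agt q \<and> \<pi> (y q) = f * a
        \<and> (\<forall>r\<in>L. z q r \<in> Acomp r) \<and> (\<forall>r. \<not> le q r \<longrightarrow> z q r = 0) \<and> z q q = a \<and> \<pi> (y q) = (\<Sum>r\<in>L. z q r)" ..
    from bchoice[OF this] obtain a where za: "\<And>q. q \<in> L \<Longrightarrow> a q \<in> Acomp q \<and> f * a q - a q \<in> Agt q \<and> \<pi> (y q) = f * a q
        \<and> (\<forall>r\<in>L. z q r \<in> Acomp r) \<and> (\<forall>r. \<not> le q r \<longrightarrow> z q r = 0) \<and> z q q = a q \<and> \<pi> (y q) = (\<Sum>r\<in>L. z q r)"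
      by blast
    have pL: "p \<in> L" and SL: "S \<subseteq> L" using pS unfolding S_def by auto
    have z_sum: "\<pi> (y q) = (\<Sum>r\<in>L. z q r)" and z_Acomp: "\<forall>r\<in>L. z q r \<in> Acomp r"
      and z_zero: "\<not> le q r \<Longrightarrow> z q r = 0" if "q \<in> S" for q r
      using za[of q] SL that by blast+
    have "(\<Sum>r\<in>L. \<Sum>q\<in>S. z q r) = (\<Sum>q\<in>S. \<Sum>r\<in>L. z q r)" by (rule sum.swap)
    also have "\<dots> = (\<Sum>q\<in>S. \<pi> (y q))" using z_sum by simp
    also have "\<dots> = (\<Sum>q\<in>L. \<pi> (y q))"
      using finL by (intro sum.mono_neutral_left) (auto simp: S_def)
    also have "\<dots> = 0" using yN yC by (simp add: N \<pi>_sum)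
    finally have "(\<Sum>r\<in>L. \<Sum>q\<in>S. z q r) = 0" .
    moreover have "\<forall>r\<in>L. (\<Sum>q\<in>S. z q r) \<in> Acomp r"
      using z_Acomp Acomp_sub by (auto intro!: subspace_sum)
    ultimately have "(\<Sum>q\<in>S. z q p) = 0"
      using direct[rule_format, of "\<lambda>r. \<Sum>q\<in>S. z q r"] pL by simp
    moreover have "(\<Sum>q\<in>S. z q p) = (\<Sum>q\<in>S. if q = p then a p else 0)"
      using za[OF pL] z_zero min by (intro sum.cong) auto
    ultimately have "a p = 0" using pS \<open>finite S\<close> by simp
    then show False using za[OF pL] pS unfolding S_def by simp
  qed
  have lay': "layer_tensor sc C u N (Age' p) {y \<in> C. \<pi> y \<in> Agt p}" if p: "p \<in> L" for p
    unfolding Age'_def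
  proof (rule layer_tensor_vimage[OF _ H])
    show "layer_tensor sc H v {0} (Age p) (Agt p)" using lay p Agt_def by simp
  qed (use p Age Agt_ideal Agt_def in auto)
  show ?case
    unfolding std_based_def Let_def
  proof (rule exI[of _ L], rule exI[of _ le], rule exI[of _ Age'], rule exI[of _ Acomp'], unfold Agt',
      intro conjI po)
    show "\<forall>p\<in>L. subspace (Age' p) \<and> N \<subseteq> Age' p \<and> Age' p \<subseteq> C
             \<and> (\<forall>a\<in>C. \<forall>y\<in>Age' p. a * y \<in> Age' p \<and> y * a \<in> Age' p)"
      using Age' NAge' C_mult Age_ideal Age_ideal_right \<pi>_H \<pi>_mult by (simp add: Age'_def)
    show "\<forall>p\<in>L. \<forall>q\<in>L. le p q \<and> p \<noteq> q \<longrightarrow> Age' q \<subseteq> Age' p"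
      using anti unfolding Age'_def by blast
    show "\<forall>p\<in>L. subspace (Acomp' p) \<and> N \<subseteq> Acomp' p \<and> Acomp' p \<subseteq> Age' p
             \<and> ksum (Acomp' p) {y \<in> C. \<pi> y \<in> Agt p} = Age' p \<and> Acomp' p \<inter> {y \<in> C. \<pi> y \<in> Agt p} = N"
      by (intro ballI conjI Acomp' NAcomp' Acomp'_Age' sum' int')
    show "span (N \<union> (\<Union>p\<in>L. Acomp' p)) = C" by (rule gen')
    show "\<forall>y. (\<forall>p\<in>L. y p \<in> Acomp' p) \<and> (\<Sum>p\<in>L. y p) \<in> N \<longrightarrow> (\<forall>p\<in>L. y p \<in> N)"
      by (intro allI impI, elim conjE, rule direct')
    show "\<forall>p\<in>L. layer_tensor sc C u N (Age' p) {y \<in> C. \<pi> y \<in> Agt p}" by (intro ballI lay')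
  qed
qed

end

subsection \<open>Primitive idempotents and the ideals generated by them\<close>

context k_algebra
begin

lemma subspace_ideal_gen [simp]: "subspace (ideal_gen sc S)"
  unfolding ideal_gen_def by (rule subspace_span)

lemma ideal_gen_minimal:
  assumes "subspace D" and "\<And>a s b. s \<in> S \<Longrightarrow> a * s * b \<in> D"
  shows "ideal_gen sc S \<subseteq> D"
  unfolding ideal_gen_def using assms by (intro span_minimal) auto

lemma ideal_gen_base: "s \<in> S \<Longrightarrow> a * s * b \<in> ideal_gen sc S"
  unfolding ideal_gen_def by (rule span_base) blast

lemma ideal_gen_mult:
  assumes "x \<in> ideal_gen sc S" shows "a * x \<in> ideal_gen sc S" and "x * b \<in> ideal_gen sc S"
proof -
  have "ideal_gen sc S \<subseteq> {x. a * x \<in> ideal_gen sc S}"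
    by (rule ideal_gen_minimal, intro subspace_left_mult subspace_ideal_gen)
      (simp, metis ideal_gen_base mult.assoc)
  moreover have "ideal_gen sc S \<subseteq> {x. x * b \<in> ideal_gen sc S}"
    by (rule ideal_gen_minimal, intro subspace_right_mult subspace_ideal_gen)
      (simp, metis ideal_gen_base mult.assoc)
  ultimately show "a * x \<in> ideal_gen sc S" "x * b \<in> ideal_gen sc S" using assms by auto
qed

lemma ideal_gen_subset:
  assumes "S \<subseteq> ideal_gen sc T" shows "ideal_gen sc S \<subseteq> ideal_gen sc T"
  by (rule ideal_gen_minimal) (use assms ideal_gen_mult in auto)

lemma finite_dim:
  obtains Basis where "finite_dimensional_vector_space sc Basis"
proof -
  obtain S where S: "finite S" "span S = UNIV" using finite_spanning by blast
  obtain Bs where Bs: "independent Bs" "UNIV \<subseteq> span Bs"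
    using maximal_independent_subset[of UNIV] by blast
  have "finite Bs" using independent_span_bound[OF S(1) Bs(1)] S(2) by blast
  with Bs have "finite_dimensional_vector_space sc Bs"
    by unfold_locales auto
  then show thesis by (rule that)
qed

lemma dim_mono: "S \<subseteq> T \<Longrightarrow> dim S \<le> dim T"
proof -
  obtain Bs where "finite_dimensional_vector_space sc Bs" by (rule finite_dim)
  then interpret finite_dimensional_vector_space sc Bs .
  show "S \<subseteq> T \<Longrightarrow> dim S \<le> dim T" by (rule dim_subset)
qed

lemma subspace_eqI_dim: "subspace S \<Longrightarrow> subspace T \<Longrightarrow> S \<subseteq> T \<Longrightarrow> dim T \<le> dim S \<Longrightarrow> S = T"
proof -
  obtain Bs where "finite_dimensional_vector_space sc Bs" by (rule finite_dim)
  then interpret finite_dimensional_vector_space sc Bs .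
  show "subspace S \<Longrightarrow> subspace T \<Longrightarrow> S \<subseteq> T \<Longrightarrow> dim T \<le> dim S \<Longrightarrow> S = T"
    by (rule subspace_dim_equal)
qed

lemma subspace_right_ideal: "subspace {x * a | a. True}"
  by (rule subspaceI)
    (auto intro: exI[of _ 0] simp: scale_mult_right simp flip: distrib_left)

lemma subspace_left_ideal: "subspace {a * x | a. True}"
  by (rule subspaceI)
    (auto intro: exI[of _ 0] simp: scale_mult_left simp flip: distrib_right)

text \<open>Minimising the sum of the dimensions of \<open>x ^ k * A\<close> and
  \<open>A * x ^ k\<close> over positive \<open>k\<close> stops both chains at one \<open>k\<close>:
  passing to \<open>k + k\<close> can shrink neither.\<close>

lemma powers_stabilise:
  fixes x :: 'a
  obtains k a b where "0 < k" "x ^ k = x ^ k * x ^ k * a" "x ^ k = b * (x ^ k * x ^ k)"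
proof -
  define R where "R k = {x ^ k * a | a. True}" for k
  define L where "L k = {a * x ^ k | a. True}" for k
  have subR: "subspace (R k)" and subL: "subspace (L k)" for k
    unfolding R_def L_def by (rule subspace_right_ideal subspace_left_ideal)+
  obtain k where k: "0 < k" "\<And>j. 0 < j \<Longrightarrow> dim (R k) + dim (L k) \<le> dim (R j) + dim (L j)"
    using ex_has_least_nat[of "\<lambda>k. 0 < k" 1 "\<lambda>k. dim (R k) + dim (L k)"] by auto
  have sub: "R (k + k) \<subseteq> R k" "L (k + k) \<subseteq> L k"
    unfolding R_def L_def power_add by (auto, metis mult.assoc, metis mult.assoc)
  from k(2)[of "k + k"] k(1) dim_mono[OF sub(1)] dim_mono[OF sub(2)]
  have "dim (R k) \<le> dim (R (k + k))" "dim (L k) \<le> dim (L (k + k))" by auto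
  then have "R (k + k) = R k" "L (k + k) = L k"
    using sub subR subL by (simp_all add: subspace_eqI_dim)
  moreover have "x ^ k \<in> R k" "x ^ k \<in> L k"
    unfolding R_def L_def by (auto intro: exI[of _ 1])
  ultimately have "x ^ k \<in> R (k + k)" "x ^ k \<in> L (k + k)" by auto
  then show thesis
    using that k(1) unfolding R_def L_def power_add by blast
qed

lemma primitive_subidempotent:
  assumes "primitive_idem e" and "\<epsilon> * \<epsilon> = \<epsilon>" and "e * \<epsilon> = \<epsilon>" and "\<epsilon> * e = \<epsilon>"
  shows "\<epsilon> = 0 \<or> \<epsilon> = e"
proof (rule ccontr)
  assume "\<not> (\<epsilon> = 0 \<or> \<epsilon> = e)"
  then have "\<epsilon> \<noteq> 0" "e - \<epsilon> \<noteq> 0" by auto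
  moreover have "e * e = e" using assms unfolding primitive_idem_def by blast
  with assms have "(e - \<epsilon>) * (e - \<epsilon>) = e - \<epsilon>" "\<epsilon> * (e - \<epsilon>) = 0" "(e - \<epsilon>) * \<epsilon> = 0" "e = \<epsilon> + (e - \<epsilon>)"
    by (simp_all add: algebra_simps)
  ultimately show False using assms unfolding primitive_idem_def by blast
qed

text \<open>A form of Fitting's lemma: \<open>e * A * e\<close> is local. Once the powers are
  stable, \<open>\<epsilon>\<close>, which is both \<open>x ^ k * a\<close> and
  \<open>b * x ^ k\<close>, is an idempotent below \<open>e\<close>. If it is 0 then
  \<open>x ^ k\<close> vanishes; if it is \<open>e\<close> then \<open>x\<close> has inverses on
  both sides.\<close>

lemma nilpotent_or_unit:
  fixes e x :: 'a
  assumes e: "primitive_idem e" and x: "e * x = x" "x * e = x"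
  shows "(\<exists>k. x ^ k = 0) \<or> (\<exists>v. e * v = v \<and> v * e = v \<and> v * x = e \<and> x * v = e)"
proof -
  obtain k a b where k: "0 < k" and a: "x ^ k = x ^ k * x ^ k * a" and b: "x ^ k = b * (x ^ k * x ^ k)"
    by (rule powers_stabilise[of x])
  define \<epsilon> where "\<epsilon> = x ^ k * a"
  obtain j where j: "k = Suc j" using k gr0_implies_Suc by blast
  have ex: "e * x ^ k = x ^ k" "x ^ k * e = x ^ k"
    unfolding j using x by (simp add: mult.assoc[symmetric], metis mult.assoc power_Suc2)
  have \<epsilon>b: "\<epsilon> = b * x ^ k" unfolding \<epsilon>_def using a b by (metis mult.assoc)
  have \<epsilon>x: "\<epsilon> * x ^ k = x ^ k" unfolding \<epsilon>b using b by (simp add: mult.assoc)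
  have "\<epsilon> * \<epsilon> = \<epsilon>" using \<epsilon>x unfolding \<epsilon>_def by (metis mult.assoc)
  moreover have "e * \<epsilon> = \<epsilon>" unfolding \<epsilon>_def using ex by (metis mult.assoc)
  moreover have "\<epsilon> * e = \<epsilon>" unfolding \<epsilon>b using ex by (metis mult.assoc)
  ultimately consider "\<epsilon> = 0" | "\<epsilon> = e" using primitive_subidempotent[OF e] by blast
  then show ?thesis
  proof cases
    case 1
    then show ?thesis using \<epsilon>x by auto
  next
    case 2
    \<comment> \<open>Splitting one factor \<open>x\<close> off \<open>x ^ k\<close> on either side
      gives a left and a right inverse in \<open>e * A * e\<close>; they coincide.\<close>
    define l r where "l = e * b * x ^ j * e" and "r = e * x ^ j * a * e"
    have ee: "e * e = e" using e unfolding primitive_idem_def by blast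
    have "l * x = e * (b * (x ^ j * x))" unfolding l_def using x by (simp add: mult.assoc)
    then have lx: "l * x = e" using 2 \<epsilon>b j ee by (simp add: power_commutes)
    have "x * r = (x * e) * x ^ j * a * e" unfolding r_def by (simp add: mult.assoc)
    then have xr: "x * r = e" using 2 \<epsilon>_def j ee x by simp
    have "l = l * (x * r)" unfolding xr l_def using ee by (simp add: mult.assoc)
    also have "\<dots> = e * r" using lx by (simp flip: mult.assoc)
    also have "\<dots> = r" unfolding r_def using ee by (simp flip: mult.assoc)
    finally have "l = r" .
    then have "e * r = r" "r * e = r" "r * x = e" "x * r = e"
      using lx xr ee unfolding r_def by (simp_all add: mult.assoc) (simp flip: mult.assoc)
    then show ?thesis by blast
  qed
qed

lemma geometric_sum_right: "(\<Sum>j<m. z ^ j) * (1 - z) = 1 - z ^ m" for z :: 'a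
proof (induction m)
  case (Suc m)
  have "(\<Sum>j<Suc m. z ^ j) * (1 - z) = (\<Sum>j<m. z ^ j) * (1 - z) + (z ^ m - z ^ m * z)"
    by (simp add: algebra_simps)
  then show ?case using Suc by (simp add: power_commutes)
qed simp

text \<open>Cancelling one factor \<open>y\<close> by \<open>l\<close> turns
  \<open>y ^ Suc k = 0\<close> into \<open>e * y ^ k = 0\<close>. This reads
  \<open>y ^ k = 0\<close> for positive \<open>k\<close>, but \<open>e = 0\<close> for
  \<open>k = 0\<close>, since \<open>y ^ 0\<close> is 1.\<close>

lemma left_unit_not_nilpotent:
  fixes l y e :: 'a
  assumes "l * y = e" and "e * y = y" and "e \<noteq> 0"
  shows "y ^ k \<noteq> 0"
proof (induction k)
  case (Suc k)
  show ?case
  proof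
    assume 0: "y ^ Suc k = 0"
    then have "e * y ^ k = 0" using assms(1) by (metis mult.assoc mult_zero_right power_Suc)
    then show False
      using Suc assms 0 by (cases k) (auto simp flip: mult.assoc)
  qed
qed simp

text \<open>Non-units of the local ring \<open>e * A * e\<close> are closed under addition. If
  \<open>x\<close> and \<open>y\<close> are nilpotent, so is \<open>v * x\<close>, since an inverse
  of it would give \<open>x\<close> a left inverse. The geometric series for
  \<open>1 - v * x\<close> then gives \<open>y\<close> a left inverse, a contradiction.\<close>

lemma unit_summand:
  fixes e x y v :: 'a
  assumes e: "primitive_idem e" and x: "e * x = x" "x * e = x" and y: "e * y = y" "y * e = y"
    and v: "e * v = v" "v * e = v" "v * (x + y) = e"
  shows "(\<exists>v. e * v = v \<and> v * e = v \<and> v * x = e \<and> x * v = e)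
       \<or> (\<exists>v. e * v = v \<and> v * e = v \<and> v * y = e \<and> y * v = e)"
proof (rule ccontr)
  assume neg: "\<not> ?thesis"
  have e0: "e \<noteq> 0" and ee: "e * e = e" using e unfolding primitive_idem_def by auto
  from neg obtain k where k: "x ^ k = 0" using nilpotent_or_unit[OF e x] by blast
  from neg obtain k' where k': "y ^ k' = 0" using nilpotent_or_unit[OF e y] by blast
  have vx: "e * (v * x) = v * x" "(v * x) * e = v * x" using v x by (metis mult.assoc)+
  have "\<nexists>w. e * w = w \<and> w * e = w \<and> w * (v * x) = e \<and> (v * x) * w = e"
    using left_unit_not_nilpotent[of _ x e k] k x e0 by (metis mult.assoc)
  then obtain m where m: "(v * x) ^ m = 0" using nilpotent_or_unit[OF e vx] by blast
  have "v * y = (1 - v * x) * e"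
    using v(3) vx by (simp add: algebra_simps)
  then have "(\<Sum>j<m. (v * x) ^ j) * v * y = e"
    using geometric_sum_right[of "v * x" m] m by (metis diff_zero mult.assoc mult_1)
  then show False using left_unit_not_nilpotent[of _ y e k'] k' y e0 by blast
qed

lemma unit_summand_sum:
  fixes e v :: 'a
  assumes e: "primitive_idem e" and x: "\<And>i. i \<in> S \<Longrightarrow> e * x i = x i \<and> x i * e = x i" and "finite S"
    and v: "e * v = v" "v * e = v" "v * (\<Sum>i\<in>S. x i) = e"
  shows "\<exists>i\<in>S. \<exists>v. e * v = v \<and> v * e = v \<and> v * x i = e \<and> x i * v = e"
  using \<open>finite S\<close> x v
proof (induction S arbitrary: v rule: finite_induct)
  case empty
  then show ?case using e unfolding primitive_idem_def by simp
next
  case (insert i S)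
  have "e * (\<Sum>i\<in>S. x i) = (\<Sum>i\<in>S. x i)" "(\<Sum>i\<in>S. x i) * e = (\<Sum>i\<in>S. x i)"
    using insert(4) by (simp_all add: sum_distrib_left sum_distrib_right)
  with unit_summand[OF e, of "x i" "\<Sum>i\<in>S. x i" v] insert show ?case by auto
qed

lemma idem_equiv_refl: "idem_equiv sc f f"
  unfolding idem_equiv_def by (rule exI[of _ id]) auto

lemma idem_equivI:
  fixes e f p q :: 'a
  assumes "f * p = p" "p * e = p" "e * q = q" "q * f = q" "q * p = e" "p * q = f"
  shows "idem_equiv sc f e"
  unfolding idem_equiv_def
proof (intro exI[of _ "\<lambda>x. x * p"] conjI)
  show "bij_betw (\<lambda>x. x * p) {a * f |a. True} {a * e |a. True}"
  proof (rule bij_betw_byWitness[where f' = "\<lambda>x. x * q"])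
    show "(\<lambda>x. x * p) ` {a * f |a. True} \<subseteq> {a * e |a. True}"
      using assms by auto (metis mult.assoc)
    show "(\<lambda>x. x * q) ` {a * e |a. True} \<subseteq> {a * f |a. True}"
      using assms by auto (metis mult.assoc)
  qed (use assms in \<open>auto simp: mult.assoc\<close>)
qed (auto simp: distrib_right scale_mult_left mult.assoc)

text \<open>The preimage \<open>a * f\<close> of \<open>e\<close> equals \<open>a * f * f\<close>,
  so linearity moves \<open>a * f\<close> out of the isomorphism. Hence \<open>e\<close> lies in the
  ideal generated by \<open>f\<close>.\<close>

lemma idem_equiv_imp_factor:
  assumes "idem_equiv sc f e" and "f * f = f" and "e * e = e"
  obtains a b where "e = a * f * b"
proof -
  obtain \<phi> where bij: "bij_betw \<phi> {a * f |a. True} {a * e |a. True}"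
    and lin: "\<And>a x. x \<in> {a * f |a. True} \<Longrightarrow> \<phi> (a * x) = a * \<phi> x"
    using assms unfolding idem_equiv_def by blast
  have "e \<in> {a * e |a. True}" using assms(3) by (auto intro: exI[of _ 1])
  then obtain a where a: "e = \<phi> (a * f)" using bij unfolding bij_betw_def by blast
  have f: "f \<in> {a * f |a. True}" by (auto intro: exI[of _ 1])
  from a have "e = \<phi> (a * (f * f))" using assms(2) by simp
  then have "e = a * f * \<phi> f" using lin[OF f, of "a * f"] assms(2) by (simp add: mult.assoc)
  then show thesis by (rule that)
qed

text \<open>\<open>e\<close> is the sum of the elements \<open>e * es i * e\<close>, so one of them
  is invertible in the local ring \<open>e * A * e\<close>; its inverse \<open>v\<close> transports
  \<open>e\<close> into \<open>es i * A * es i\<close>. In particular the minimum in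
  \<open>F_A\<close> exists.\<close>

lemma primitive_equiv_summand:
  assumes e: "primitive_idem e" and es: "idem_grading n es"
  shows "\<exists>i\<le>n. \<exists>f. f \<in> {es i * a * es i |a. True} \<and> f * f = f \<and> idem_equiv sc f e"
proof -
  have ee: "e * e = e" using e unfolding primitive_idem_def by blast
  have "(\<Sum>i\<le>n. e * es i * e) = e * (\<Sum>i\<le>n. es i) * e" by (simp add: sum_distrib_left sum_distrib_right)
  then have "e * (\<Sum>i\<in>{..n}. e * es i * e) = e" using es ee unfolding idem_grading_def by simp
  from unit_summand_sum[OF e _ _ ee ee this]
  have "\<exists>i\<in>{..n}. \<exists>v. e * v = v \<and> v * e = v \<and> v * (e * es i * e) = e \<and> e * es i * e * v = e"
    using ee by (simp add: mult.assoc) (simp flip: mult.assoc)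
  then obtain i v where i: "i \<le> n" and v: "e * v = v" "v * e = v" "e * es i * e * v = e"
    by blast
  have ei: "es i * es i = es i" using es i unfolding idem_grading_def by blast
  define f where "f = es i * v * es i"
  define p q where "p = es i * v" and "q = e * es i"
  have ev: "e * (v * x) = v * x" "es i * (es i * x) = es i * x" "v * (e * x) = v * x" for x
    using v ei by (simp_all flip: mult.assoc)
  have qp: "q * p = e" unfolding p_def q_def using v ei by (metis mult.assoc)
  have fq: "f = p * q" unfolding f_def p_def q_def by (simp add: mult.assoc ev)
  have pe: "p * e = p" and eq: "e * q = q" unfolding p_def q_def using v ee by (metis mult.assoc)+
  moreover have "f * p = p" unfolding fq using qp pe by (simp add: mult.assoc)
  moreover have "q * f = q" unfolding fq using qp eq by (simp flip: mult.assoc)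
  moreover have "f * f = f" using \<open>f * p = p\<close> fq by (metis mult.assoc)
  moreover note qp fq[symmetric]
  ultimately have "idem_equiv sc f e" "f * f = f" by (auto intro: idem_equivI)
  then show ?thesis using i f_def by blast
qed

text \<open>Splitting a non-primitive idempotent lowers the dimension of its right ideal. Using only
  primitive idempotents below \<open>\<epsilon>\<close> is what bounds their \<open>F_A\<close> in
  \<open>Jideal_eq\<close>.\<close>

lemma idempotent_in_primitive_ideal:
  assumes "\<epsilon> * \<epsilon> = \<epsilon>"
  shows "\<epsilon> \<in> ideal_gen sc {e. primitive_idem e \<and> \<epsilon> * e = e \<and> e * \<epsilon> = e}"
  using assms
proof (induction "dim {\<epsilon> * a | a. True}" arbitrary: \<epsilon> rule: less_induct)
  case less
  consider "\<epsilon> = 0" | "primitive_idem \<epsilon>" | f g where "f \<noteq> 0" "g \<noteq> 0" "f * f = f" "g * g = g"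
    "f * g = 0" "g * f = 0" "\<epsilon> = f + g"
    using less.prems unfolding primitive_idem_def by blast
  then show ?case
  proof cases
    case 1
    then show ?thesis by (simp add: subspace_0)
  next
    case 2
    then show ?thesis using ideal_gen_base[of \<epsilon> _ 1 1] less.prems by simp
  next
    case 3
    have *: "f' \<in> ideal_gen sc {e. primitive_idem e \<and> \<epsilon> * e = e \<and> e * \<epsilon> = e}"
      if f': "g' \<noteq> 0" "f' * f' = f'" "g' * g' = g'" "f' * g' = 0" "g' * f' = 0" "\<epsilon> = f' + g'" for f' g'
    proof -
      have \<epsilon>f: "\<epsilon> * f' = f'" "f' * \<epsilon> = f'" "\<epsilon> * g' = g'" using f' by (simp_all add: algebra_simps)
      have sub: "{f' * a | a. True} \<subseteq> {\<epsilon> * a | a. True}"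
        using \<epsilon>f by auto (metis mult.assoc)
      have "g' \<in> {\<epsilon> * a | a. True}" using \<epsilon>f by auto metis
      moreover have "g' \<notin> {f' * a | a. True}"
      proof
        assume "g' \<in> {f' * a | a. True}"
        then have "f' * g' = g'" using f'(2) by (auto simp flip: mult.assoc)
        then show False using f' by simp
      qed
      ultimately have "dim {f' * a | a. True} < dim {\<epsilon> * a | a. True}"
        using subspace_eqI_dim[OF subspace_right_ideal subspace_right_ideal sub]
        by (cases "dim {f' * a | a. True} < dim {\<epsilon> * a | a. True}") (auto simp only: not_less)
      from less.hyps[OF this f'(2)]
      have "f' \<in> ideal_gen sc {e. primitive_idem e \<and> f' * e = e \<and> e * f' = e}" .
      moreover have "\<epsilon> * e = e \<and> e * \<epsilon> = e" if "f' * e = e" "e * f' = e" for e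
        using that \<epsilon>f by (metis mult.assoc)
      then have "{e. primitive_idem e \<and> f' * e = e \<and> e * f' = e}
          \<subseteq> {e. primitive_idem e \<and> \<epsilon> * e = e \<and> e * \<epsilon> = e}" by blast
      then have "ideal_gen sc {e. primitive_idem e \<and> f' * e = e \<and> e * f' = e}
        \<subseteq> ideal_gen sc {e. primitive_idem e \<and> \<epsilon> * e = e \<and> e * \<epsilon> = e}"
        unfolding ideal_gen_def by (intro span_mono) blast
      ultimately show ?thesis by blast
    qed
    have "f \<in> ideal_gen sc {e. primitive_idem e \<and> \<epsilon> * e = e \<and> e * \<epsilon> = e}"
      "g \<in> ideal_gen sc {e. primitive_idem e \<and> \<epsilon> * e = e \<and> e * \<epsilon> = e}"
      using *[of g f] *[of f g] 3 by (auto simp: add.commute)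
    then show ?thesis using 3(7) subspace_add[OF subspace_ideal_gen] by blast
  qed
qed

text \<open>A primitive \<open>e\<close> with \<open>F_A\<close> equal to \<open>k\<close> is
  equivalent to an idempotent of \<open>es k * A * es k\<close>, so it lies in the ideal of
  \<open>es k\<close>. Conversely \<open>es k\<close> lies in the ideal of the primitive idempotents
  below it, each of which witnesses its own bound \<open>k\<close>.\<close>

lemma Jideal_eq:
  assumes es: "idem_grading n es"
  shows "Jideal sc n es d = ideal_gen sc {es k | k. k < d \<and> k \<le> n}"
  unfolding Jideal_def
proof (rule antisym; rule ideal_gen_subset; rule subsetI)
  fix e assume "e \<in> {e. primitive_idem e \<and> F_A sc n es e < d}"
  then have e: "primitive_idem e" "F_A sc n es e < d" by auto
  from LeastI_ex[OF primitive_equiv_summand[OF e(1) es]]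
  obtain f where f: "F_A sc n es e \<le> n" "f \<in> {es (F_A sc n es e) * a * es (F_A sc n es e) |a. True}"
    "f * f = f" "idem_equiv sc f e"
    unfolding F_A_def by blast
  have "e * e = e" using e unfolding primitive_idem_def by blast
  with f obtain a b where ab: "e = a * f * b" using idem_equiv_imp_factor by blast
  have "f \<in> ideal_gen sc {es k |k. k < d \<and> k \<le> n}"
  proof -
    have "es (F_A sc n es e) \<in> {es k |k. k < d \<and> k \<le> n}" using f(1) e(2) by blast
    from ideal_gen_base[OF this] have "1 * es (F_A sc n es e) * b \<in> ideal_gen sc {es k |k. k < d \<and> k \<le> n}" for b .
    then show ?thesis using f(2) by (auto simp: mult.assoc)
  qed
  then show "e \<in> ideal_gen sc {es k |k. k < d \<and> k \<le> n}"
    unfolding ab by (intro ideal_gen_mult)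
next
  fix x assume "x \<in> {es k |k. k < d \<and> k \<le> n}"
  then obtain k where k: "x = es k" "k < d" "k \<le> n" by blast
  have xx: "x * x = x" using es k unfolding idem_grading_def by blast
  have "F_A sc n es e < d" if "primitive_idem e" "x * e = e" "e * x = e" for e
  proof -
    have "e \<in> {es k * a * es k |a. True}" using that k by auto metis
    moreover have "e * e = e" using that unfolding primitive_idem_def by blast
    ultimately have "F_A sc n es e \<le> k"
      unfolding F_A_def using k(3) idem_equiv_refl by (intro Least_le) blast
    then show ?thesis using k by simp
  qed
  then have "ideal_gen sc {e. primitive_idem e \<and> x * e = e \<and> e * x = e}
      \<subseteq> ideal_gen sc {e. primitive_idem e \<and> F_A sc n es e < d}"
    unfolding ideal_gen_def by (intro span_mono) blast
  then show "x \<in> ideal_gen sc {e. primitive_idem e \<and> F_A sc n es e < d}"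
    using idempotent_in_primitive_ideal[OF xx] by blast
qed

end

subsection \<open>Pre-Borelic subalgebras\<close>

locale pre_borelic = k_algebra sc for sc :: "'k::field \<Rightarrow> 'a::ring_1 \<Rightarrow> 'a" +
  fixes n :: nat and es :: "nat \<Rightarrow> 'a" and B :: "'a set"
  assumes grading: "idem_grading n es" and borelic: "graded_pre_Borelic sc n es B"
begin

lemma es_mult: "i \<le> n \<Longrightarrow> k \<le> n \<Longrightarrow> es i * es k = (if i = k then es i else 0)"
  using grading unfolding idem_grading_def by auto

lemma es_mult_assoc: "i \<le> n \<Longrightarrow> k \<le> n \<Longrightarrow> es i * (es k * x) = (if i = k then es i * x else 0)"
  by (simp add: es_mult flip: mult.assoc)

lemma sum_es: "(\<Sum>i\<le>n. es i) = 1"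
  using grading unfolding idem_grading_def by blast

lemma sum_es_left: "x = (\<Sum>i\<le>n. es i * x)" and sum_es_right: "x = (\<Sum>i\<le>n. x * es i)"
  by (simp_all add: sum_es flip: sum_distrib_left sum_distrib_right)

lemma subspace_es_zero: "subspace {a. \<forall>i k. P i k \<longrightarrow> es i * a * es k = 0}"
  by (rule subspaceI) (auto simp: distrib_left distrib_right simp flip: scale_mult_left scale_mult_right)

text \<open>Every \<open>a\<close> is the sum of its corners \<open>es i * a * es k\<close>, of
  degree \<open>k - i\<close>, so degrees become vanishing conditions. In this picture
  \<open>Aneg\<close> is strictly lower triangular and \<open>B\<close> upper triangular.\<close>

lemma grade_iff: "a \<in> grade sc n es j \<longleftrightarrow> (\<forall>i k. i \<le> n \<and> k \<le> n \<and> int k \<noteq> int i + j \<longrightarrow> es i * a * es k = 0)"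
proof
  let ?D = "{a. \<forall>i k. i \<le> n \<and> k \<le> n \<and> int k \<noteq> int i + j \<longrightarrow> es i * a * es k = 0}"
  have "grade sc n es j \<subseteq> ?D"
    unfolding grade_def
    by (intro span_minimal subspace_es_zero) (auto simp: mult.assoc es_mult es_mult_assoc)
  then show "a \<in> grade sc n es j \<Longrightarrow> \<forall>i k. i \<le> n \<and> k \<le> n \<and> int k \<noteq> int i + j \<longrightarrow> es i * a * es k = 0"
    by blast
next
  assume zero: "\<forall>i k. i \<le> n \<and> k \<le> n \<and> int k \<noteq> int i + j \<longrightarrow> es i * a * es k = 0"
  have "es i * a * es k \<in> grade sc n es j" if "i \<le> n" "k \<le> n" for i k
  proof (cases "int k = int i + j")
    case True
    then have k: "k = nat (int i + j)" "0 \<le> int i + j" "int i + j \<le> int n" using that by linarith+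
    then have "es i * a * es (nat (int i + j))
        \<in> {es i * a * es (nat (int i + j)) | i a. i \<le> n \<and> 0 \<le> int i + j \<and> int i + j \<le> int n}"
      using that by blast
    then show ?thesis unfolding grade_def k(1)[symmetric] by (rule span_base)
  next
    case False
    then show ?thesis using zero that by (simp add: grade_def span_zero)
  qed
  then have "(\<Sum>k\<le>n. \<Sum>i\<le>n. es i * a * es k) \<in> grade sc n es j"
    unfolding grade_def by (intro span_sum) auto
  also have "(\<Sum>k\<le>n. \<Sum>i\<le>n. es i * a * es k) = a"
    by (simp add: sum_es flip: sum_distrib_left sum_distrib_right)
  finally show "a \<in> grade sc n es j" .
qed

lemma grade_left:
  assumes "b \<in> grade sc n es j" "i \<le> n" "k \<le> n" "int k = int i + j"
  shows "es i * b = es i * b * es k"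
proof -
  have "es i * b = (\<Sum>l\<le>n. es i * b * es l)" by (rule sum_es_right)
  also have "\<dots> = (\<Sum>l\<le>n. if l = k then es i * b * es k else 0)"
    using assms by (intro sum.cong) (auto simp: grade_iff)
  finally show ?thesis using assms by simp
qed

lemma grade_right:
  assumes "b \<in> grade sc n es j" "i \<le> n" "k \<le> n" "int k = int i + j"
  shows "b * es k = es i * b * es k"
proof -
  have "b * es k = (\<Sum>l\<le>n. es l * (b * es k))" by (rule sum_es_left)
  also have "\<dots> = (\<Sum>l\<le>n. if l = i then es i * b * es k else 0)"
    using assms by (intro sum.cong) (auto simp: grade_iff mult.assoc)
  finally show ?thesis using assms by simp
qed

text \<open>A homogeneous element has at most one nonzero corner in each row and column, so
  idempotents move across it with a shift of index.\<close>

lemma grade_shift: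
  assumes "b \<in> grade sc n es j" "i \<le> n" "k \<le> n" "int k = int i + j"
  shows "b * es k = es i * b"
  using grade_left[OF assms] grade_right[OF assms] by simp

lemma grade_right_zero:
  assumes "b \<in> grade sc n es j" "k \<le> n" "int k < j"
  shows "b * es k = 0"
proof -
  have "b * es k = (\<Sum>l\<le>n. es l * (b * es k))" by (rule sum_es_left)
  also have "\<dots> = 0" using assms by (intro sum.neutral) (auto simp: grade_iff mult.assoc)
  finally show ?thesis .
qed

lemma Aneg_iff: "a \<in> Aneg sc n es \<longleftrightarrow> (\<forall>i k. i \<le> k \<and> k \<le> n \<longrightarrow> es i * a * es k = 0)"
proof
  let ?D = "{a. \<forall>i k. i \<le> k \<and> k \<le> n \<longrightarrow> es i * a * es k = 0}"
  have "Aneg sc n es \<subseteq> ?D"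
    unfolding Aneg_def
    by (intro span_minimal subspace_es_zero) (auto simp: grade_iff)
  then show "a \<in> Aneg sc n es \<Longrightarrow> \<forall>i k. i \<le> k \<and> k \<le> n \<longrightarrow> es i * a * es k = 0" by blast
next
  assume zero: "\<forall>i k. i \<le> k \<and> k \<le> n \<longrightarrow> es i * a * es k = 0"
  have "es i * a * es k \<in> Aneg sc n es" if "i \<le> n" "k \<le> n" for i k
  proof (cases "i \<le> k")
    case True
    then show ?thesis using zero that by (simp add: Aneg_def span_zero)
  next
    case False
    then have "es i * a * es k \<in> grade sc n es (int k - int i)"
      using that by (auto simp: grade_iff mult.assoc es_mult es_mult_assoc)
    then show ?thesis unfolding Aneg_def using False by (intro span_base UN_I[of "int k - int i"]) auto
  qed
  then have "(\<Sum>k\<le>n. \<Sum>i\<le>n. es i * a * es k) \<in> Aneg sc n es"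
    unfolding Aneg_def by (intro span_sum) auto
  also have "(\<Sum>k\<le>n. \<Sum>i\<le>n. es i * a * es k) = a"
    by (simp add: sum_es flip: sum_distrib_left sum_distrib_right)
  finally show "a \<in> Aneg sc n es" .
qed

lemma subspace_Aneg: "subspace (Aneg sc n es)"
  unfolding Aneg_def by (rule subspace_span)

lemma es_Aneg_es: "x \<in> Aneg sc n es \<Longrightarrow> i \<le> n \<Longrightarrow> k \<le> n \<Longrightarrow> es i * x * es k \<in> Aneg sc n es"
  by (auto simp: Aneg_iff mult.assoc es_mult es_mult_assoc)

lemma grade0_Aneg:
  assumes "a \<in> grade sc n es 0" "x \<in> Aneg sc n es"
  shows "a * x \<in> Aneg sc n es"
  unfolding Aneg_iff
proof (intro allI impI)
  fix i k assume ik: "i \<le> k \<and> k \<le> n"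
  then have "es i * (a * x) * es k = a * (es i * x * es k)"
    using grade_shift[OF assms(1), of i i] by (simp flip: mult.assoc)
  then show "es i * (a * x) * es k = 0" using assms(2) ik unfolding Aneg_iff by simp
qed

lemma
  subspace_B: "subspace B"
  and B_mult: "\<And>a b. a \<in> B \<Longrightarrow> b \<in> B \<Longrightarrow> a * b \<in> B"
  and B_graded: "B = span (\<Union>j. B \<inter> grade sc n es j)"
  and B_neg: "\<And>j. j < 0 \<Longrightarrow> B \<inter> grade sc n es j = {0}"
  using borelic unfolding graded_pre_Borelic_def graded_subalg_def by (simp_all only: simp_thms Ball_def)

lemma B_induct [consumes 1, case_names subspace homogeneous]:
  assumes "b \<in> B" and "subspace {b. P b}"
    and hom: "\<And>b t. b \<in> B \<Longrightarrow> b \<in> grade sc n es (int t) \<Longrightarrow> P b"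
  shows "P b"
proof -
  have "B \<inter> grade sc n es j \<subseteq> {b. P b}" for j
  proof (cases "j < 0")
    case True
    then show ?thesis using B_neg[OF True] subspace_0[OF assms(2)] by auto
  next
    case False
    then show ?thesis using hom[of _ "nat j"] by auto
  qed
  then have "span (\<Union>j. B \<inter> grade sc n es j) \<subseteq> {b. P b}"
    using assms(2) by (intro span_minimal) auto
  then show ?thesis using assms(1) B_graded by auto
qed

lemma B_lower_zero:
  assumes "b \<in> B" "k < i" "i \<le> n"
  shows "es i * b * es k = 0"
  using assms(1)
proof (induction rule: B_induct)
  case subspace
  show ?case
    by (rule subspaceI) (auto simp: distrib_left distrib_right simp flip: scale_mult_left scale_mult_right)
next
  case (homogeneous b t)
  then show ?case using assms by (auto simp: grade_iff)
qed

definition AnB :: "'a set" where "AnB = span {x * b | x b. x \<in> Aneg sc n es \<and> b \<in> B}"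

lemma AnB_complement: "ksum B AnB = UNIV" "B \<inter> AnB = {0}"
  using borelic unfolding graded_pre_Borelic_def AnB_def Let_def by simp_all

lemma subspace_AnB: "subspace AnB"
  unfolding AnB_def by (rule subspace_span)

lemma AnB_base: "x \<in> Aneg sc n es \<Longrightarrow> b \<in> B \<Longrightarrow> x * b \<in> AnB"
  unfolding AnB_def by (rule span_base) blast

lemma AnB_minimal:
  assumes "subspace D" and "\<And>x b. x \<in> Aneg sc n es \<Longrightarrow> b \<in> B \<Longrightarrow> x * b \<in> D"
  shows "AnB \<subseteq> D"
  unfolding AnB_def using assms by (intro span_minimal) auto

lemma AnB_right:
  assumes "y \<in> AnB" "b \<in> B" shows "y * b \<in> AnB"
proof -
  have "AnB \<subseteq> {y. y * b \<in> AnB}"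
    using assms(2)
    by (intro AnB_minimal subspace_right_mult subspace_AnB) (simp add: mult.assoc AnB_base B_mult)
  then show ?thesis using assms by blast
qed

lemma AnB_left:
  assumes "y \<in> AnB" "a \<in> grade sc n es 0" shows "a * y \<in> AnB"
proof -
  have "AnB \<subseteq> {y. a * y \<in> AnB}"
    using assms(2)
    by (intro AnB_minimal subspace_left_mult subspace_AnB)
      (simp add: grade0_Aneg AnB_base flip: mult.assoc)
  then show ?thesis using assms by blast
qed

definition prB :: "'a \<Rightarrow> 'a" where "prB a = (THE b. b \<in> B \<and> a - b \<in> AnB)"

lemma prB_eqI:
  assumes "b \<in> B" "a - b \<in> AnB" shows "prB a = b"
  unfolding prB_def
proof (rule the_equality)
  fix c assume c: "c \<in> B \<and> a - c \<in> AnB"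
  then have "c - b \<in> B" using assms subspace_diff[OF subspace_B] by blast
  moreover have "(a - b) - (a - c) \<in> AnB" using assms c subspace_diff[OF subspace_AnB] by blast
  ultimately have "c - b \<in> B \<inter> AnB" by simp
  then show "c = b" using AnB_complement by simp
qed (use assms in blast)

lemma prB_B: "prB a \<in> B" and prB_AnB: "a - prB a \<in> AnB"
proof -
  have "a \<in> ksum B AnB" using AnB_complement by simp
  then obtain b y where "b \<in> B" "y \<in> AnB" "a = b + y" unfolding ksum_def by blast
  then have b: "b \<in> B" "a - b \<in> AnB" by auto
  then show "prB a \<in> B" "a - prB a \<in> AnB" using prB_eqI[OF b] by auto
qed

lemma prB_id: "b \<in> B \<Longrightarrow> prB b = b"
  by (rule prB_eqI) (simp_all add: subspace_0[OF subspace_AnB])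

lemma prB_zero_iff: "prB a = 0 \<longleftrightarrow> a \<in> AnB"
  using prB_AnB[of a] prB_eqI[of 0 a] subspace_0[OF subspace_B] by auto

lemma prB_add: "prB (x + y) = prB x + prB y"
proof (rule prB_eqI)
  have "(x - prB x) + (y - prB y) \<in> AnB" using prB_AnB subspace_add[OF subspace_AnB] by blast
  then show "x + y - (prB x + prB y) \<in> AnB" by (simp add: algebra_simps)
qed (use prB_B subspace_add[OF subspace_B] in blast)

lemma prB_scale: "prB (sc c x) = sc c (prB x)"
proof (rule prB_eqI)
  show "sc c x - sc c (prB x) \<in> AnB"
    using prB_AnB subspace_scale[OF subspace_AnB] by (metis scale_right_diff_distrib)
qed (use prB_B subspace_scale[OF subspace_B] in blast)

text \<open>Left multiplication by degree zero preserves \<open>Aneg\<close>, hence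
  \<open>AnB\<close>, and \<open>AnB\<close> is a right \<open>B\<close>-module; so both error terms
  stay in \<open>AnB\<close>.\<close>

lemma prB_mult:
  assumes "a \<in> grade sc n es 0" shows "prB (a * m) = prB a * prB m"
proof (rule prB_eqI)
  have "a * (m - prB m) + (a - prB a) * prB m \<in> AnB"
    using assms prB_AnB prB_B AnB_left AnB_right subspace_add[OF subspace_AnB] by blast
  then show "a * m - prB a * prB m \<in> AnB" by (simp add: algebra_simps)
qed (use prB_B B_mult in blast)

text \<open>The projection of A onto its degree-zero part.\<close>

definition diag :: "'a \<Rightarrow> 'a" where "diag x = (\<Sum>i\<le>n. es i * x * es i)"

lemma diag_zero: "diag 0 = 0"
  unfolding diag_def by simp

lemma diag_add: "diag (x + y) = diag x + diag y"
  unfolding diag_def by (simp add: distrib_left distrib_right sum.distrib)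

lemma diag_scale: "diag (sc c x) = sc c (diag x)"
  unfolding diag_def by (simp add: scale_sum_right flip: scale_mult_left scale_mult_right)

lemma subspace_diag: "subspace S \<Longrightarrow> subspace {x. diag x \<in> S}"
  by (rule subspaceI) (auto simp: diag_zero diag_add diag_scale subspace_add subspace_scale subspace_0)

lemma es_diag: "i \<le> n \<Longrightarrow> k \<le> n \<Longrightarrow> es i * diag x * es k = (if i = k then es i * x * es i else 0)"
proof -
  assume ik: "i \<le> n" "k \<le> n"
  have "es i * diag x * es k = (\<Sum>l\<le>n. es i * (es l * x * es l) * es k)"
    unfolding diag_def by (simp add: sum_distrib_left sum_distrib_right)
  also have "\<dots> = (\<Sum>l\<le>n. if l = i then (if i = k then es i * x * es i else 0) else 0)"
    using ik by (intro sum.cong) (auto simp: mult.assoc es_mult es_mult_assoc)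
  finally show ?thesis using ik by simp
qed

lemma diag_grade0: "diag x \<in> grade sc n es 0"
  by (auto simp: grade_iff es_diag)

lemma diag_id: "x \<in> grade sc n es 0 \<Longrightarrow> diag x = x"
proof -
  assume x: "x \<in> grade sc n es 0"
  have "diag x = (\<Sum>i\<le>n. es i * x)"
    unfolding diag_def using grade_left[OF x] by (intro sum.cong) auto
  then show ?thesis by (simp add: sum_es flip: sum_distrib_right)
qed

lemma diag_B: "b \<in> B \<Longrightarrow> diag b \<in> B"
proof (induction rule: B_induct)
  case subspace
  show ?case by (rule subspace_diag[OF subspace_B])
next
  case (homogeneous b t)
  show ?case
  proof (cases "t = 0")
    case True
    then show ?thesis using homogeneous diag_id by simp
  next
    case False
    then have "diag b = 0" using homogeneous unfolding diag_def
      by (intro sum.neutral) (auto simp: grade_iff)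
    then show ?thesis using subspace_0[OF subspace_B] by simp
  qed
qed

text \<open>\<open>AnB\<close> is compatible with the grading: for \<open>b\<close> of degree
  \<open>t\<close>, moving \<open>es i\<close> across \<open>b\<close> turns the diagonal corners of
  \<open>x * b\<close> into corners \<open>(i, i - t)\<close> of \<open>x\<close>, whose sum is in
  \<open>Aneg\<close>, times \<open>b\<close>.\<close>

lemma diag_AnB: "y \<in> AnB \<Longrightarrow> diag y \<in> AnB"
proof -
  have "diag (x * b) \<in> AnB" if x: "x \<in> Aneg sc n es" and "b \<in> B" for x b
    using that(2)
  proof (induction rule: B_induct)
    case subspace
    show ?case
      using subspace_left_mult[OF subspace_diag[OF subspace_AnB], of x] by simp
  next
    case (homogeneous b t)
    have "es i * (x * b) * es i = (if t \<le> i then es i * x * es (i - t) else 0) * b" if "i \<le> n" for i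
    proof (cases "t \<le> i")
      case True
      then show ?thesis using grade_shift[OF homogeneous(2), of "i - t" i] that by (simp add: mult.assoc)
    next
      case False
      then show ?thesis using grade_right_zero[OF homogeneous(2), of i] that by (simp add: mult.assoc)
    qed
    then have "diag (x * b) = (\<Sum>i\<le>n. if t \<le> i then es i * x * es (i - t) else 0) * b"
      unfolding diag_def sum_distrib_right by (intro sum.cong) auto
    moreover have "(\<Sum>i\<le>n. if t \<le> i then es i * x * es (i - t) else 0) \<in> Aneg sc n es"
      using es_Aneg_es[OF x] subspace_0[OF subspace_Aneg]
      by (intro subspace_sum[OF subspace_Aneg]) auto
    ultimately show ?case using homogeneous(1) AnB_base by simp
  qed
  then have "AnB \<subseteq> {y. diag y \<in> AnB}"
    by (intro AnB_minimal subspace_diag subspace_AnB) auto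
  then show "y \<in> AnB \<Longrightarrow> diag y \<in> AnB" by blast
qed

text \<open>Applying \<open>diag\<close> to the decomposition of \<open>a\<close> decomposes
  \<open>a\<close> again, so by uniqueness \<open>prB a\<close> is its own diagonal part.\<close>

lemma prB_grade0:
  assumes a: "a \<in> grade sc n es 0" shows "prB a \<in> grade sc n es 0"
proof -
  have "prB a = diag (prB a)"
  proof (rule prB_eqI)
    have "diag (prB a + (a - prB a)) = diag (prB a) + diag (a - prB a)" by (rule diag_add)
    then have "a - diag (prB a) = diag (a - prB a)" using diag_id[OF a] by (simp add: algebra_simps)
    then show "a - diag (prB a) \<in> AnB" using diag_AnB prB_AnB by simp
  qed (use diag_B prB_B in blast)
  then show ?thesis using diag_grade0 by metis
qed

abbreviation lower_ideal :: "nat \<Rightarrow> 'a set" where "lower_ideal d \<equiv> ideal_gen sc {es k | k. k < d \<and> k \<le> n}"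

text \<open>Row \<open>k\<close> of an element of \<open>Aneg\<close> lives in columns below
  \<open>k\<close>; inserting their idempotents before the factor from \<open>B\<close> gives the
  generators.\<close>

lemma es_AnB:
  assumes "y \<in> AnB" "k \<le> n"
  shows "a * es k * y \<in> span {a * es l * b | a l b. l < k \<and> b \<in> B}" (is "_ \<in> ?S")
proof -
  have "a * es k * (x * b) \<in> ?S" if "x \<in> Aneg sc n es" "b \<in> B" for x b
  proof -
    have "es k * x = (\<Sum>l\<le>n. es k * x * es l)" by (rule sum_es_right)
    also have "\<dots> = (\<Sum>l<k. es k * x * es l)"
      using that assms(2) by (intro sum.mono_neutral_right) (auto simp: Aneg_iff)
    finally have "a * (es k * x) * b = a * (\<Sum>l<k. es k * x * es l) * b" by simp
    then have "a * es k * (x * b) = (\<Sum>l<k. (a * es k * x) * es l * b)"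
      by (simp add: mult.assoc sum_distrib_left sum_distrib_right)
    also have "\<dots> \<in> ?S" using that(2) by (intro span_sum span_base) blast
    finally show ?thesis .
  qed
  then have "AnB \<subseteq> {y. a * es k * y \<in> ?S}"
    by (intro AnB_minimal subspace_left_mult subspace_span) auto
  then show ?thesis using assms by blast
qed

lemma lower_ideal_span: "lower_ideal d = span {a * es k * b | a k b. k < d \<and> k \<le> n \<and> b \<in> B}" (is "_ = ?S")
proof
  show "?S \<subseteq> lower_ideal d" by (intro span_minimal subspace_ideal_gen) (auto intro!: ideal_gen_base)
  show "lower_ideal d \<subseteq> ?S"
  proof (rule ideal_gen_minimal; clarsimp?)
    fix a k x assume k: "k < d" "k \<le> n"
    have "a * es k * x = a * es k * prB x + a * es k * (x - prB x)"
      by (simp flip: distrib_left)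
    moreover have "a * es k * prB x \<in> ?S" using k prB_B by (intro span_base) blast
    moreover have "{a * es l * b | a l b. l < k \<and> b \<in> B} \<subseteq> {a * es k * b | a k b. k < d \<and> k \<le> n \<and> b \<in> B}"
      using k by fastforce
    then have "a * es k * (x - prB x) \<in> ?S"
      using es_AnB[OF prB_AnB k(2)] span_mono by blast
    ultimately show "a * es k * x \<in> ?S" by (simp only: span_add)
  qed
qed

lemma lower_ideal_mono: "d \<le> d' \<Longrightarrow> lower_ideal d \<subseteq> lower_ideal d'"
  by (rule ideal_gen_subset) (auto intro!: ideal_gen_base[of _ _ 1 1, simplified])

end

section \<open>One layer J/I of the chain of ideals\<close>

locale stratum = pre_borelic sc n es B
  for sc :: "'k::field \<Rightarrow> 'a::ring_1 \<Rightarrow> 'a" and n :: nat and es :: "nat \<Rightarrow> 'a" and B :: "'a set" +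
  fixes d :: nat
  assumes d: "d \<le> n"
begin

abbreviation e :: 'a where "e \<equiv> es d"
abbreviation I :: "'a set" where "I \<equiv> lower_ideal d"
abbreviation J :: "'a set" where "J \<equiv> lower_ideal (Suc d)"
abbreviation H :: "'a set" where "H \<equiv> B \<inter> grade sc n es 0"

lemma ee: "e * e = e" and eex: "e * (e * x) = e * x"
  using d by (simp_all add: es_mult es_mult_assoc)

lemma I_J: "I \<subseteq> J"
  by (rule lower_ideal_mono) simp

lemma e_J: "a * e * b \<in> J"
  using d by (intro ideal_gen_base) auto

lemma J_induct [consumes 1, case_names subspace lower generator]:
  assumes "m \<in> J" and "subspace {m. P m}"
    and low: "\<And>z. z \<in> I \<Longrightarrow> P z" and gen: "\<And>a x. P (a * es d * x)"
  shows "P m"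
proof -
  have "J \<subseteq> {m. P m}"
  proof (rule ideal_gen_minimal[OF assms(2)])
    fix a s b assume "s \<in> {es k |k. k < Suc d \<and> k \<le> n}"
    then obtain k where k: "s = es k" "k \<le> d" by auto
    show "a * s * b \<in> {m. P m}"
    proof (cases "k = d")
      case True
      then show ?thesis using k gen by simp
    next
      case False
      then have "a * s * b \<in> I" using k d by (intro ideal_gen_base) auto
      then show ?thesis using low by simp
    qed
  qed
  then show ?thesis using assms(1) by blast
qed

lemma subspace_I: "subspace I"
  by (rule subspace_ideal_gen)

lemma I_right: "x \<in> I \<Longrightarrow> x * b \<in> I" and I_left: "x \<in> I \<Longrightarrow> b * x \<in> I"
  by (simp_all only: ideal_gen_mult)

lemma e_AnB: "y \<in> AnB \<Longrightarrow> e * y \<in> I"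
proof -
  assume y: "y \<in> AnB"
  have "span {a * es l * b | a l b. l < d \<and> b \<in> B} \<subseteq> I"
    using d by (intro span_minimal subspace_I) (auto intro!: ideal_gen_base)
  then show ?thesis using es_AnB[OF y d, of 1] by auto
qed

text \<open>By \<open>lower_ideal_span\<close> it is enough to treat \<open>a * es k * b\<close>
  with \<open>k < d\<close>, where \<open>e * a * es k\<close> is a strictly lower corner. With
  \<open>e_AnB\<close>, the sets \<open>I\<close> and \<open>AnB\<close> agree on elements fixed by
  left multiplication with \<open>e\<close>.\<close>

lemma e_I: "z \<in> I \<Longrightarrow> e * z \<in> AnB"
proof -
  have "I \<subseteq> {z. e * z \<in> AnB}"
    unfolding lower_ideal_span
  proof (intro span_minimal subspace_left_mult subspace_AnB, clarify)
    fix a k b assume k: "k < d" "k \<le> n" "b \<in> B"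
    have "e * a * es k \<in> Aneg sc n es"
      using k d by (auto simp: Aneg_iff mult.assoc es_mult es_mult_assoc)
    from AnB_base[OF this k(3)] show "e * (a * es k * b) \<in> AnB" by (simp add: mult.assoc)
  qed
  then show "z \<in> I \<Longrightarrow> e * z \<in> AnB" by blast
qed

lemma e_prB: "e * (m - prB m) \<in> I"
  by (rule e_AnB[OF prB_AnB])

lemma eAe_grade0: "e * a * e \<in> grade sc n es 0"
  using d by (auto simp: grade_iff mult.assoc es_mult es_mult_assoc)

lemma e_grade0: "e \<in> grade sc n es 0"
  using eAe_grade0[of 1] ee by simp

lemma H_comm: "h \<in> H \<Longrightarrow> h * e = e * h"
  using grade_shift[of h 0 d d] d by simp

lemma prB_H: "a \<in> grade sc n es 0 \<Longrightarrow> prB a \<in> H"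
  using prB_B prB_grade0 by blast

text \<open>\<open>prB\<close> is the homomorphism required by \<open>central_corner\<close>: it is
  multiplicative because \<open>e * A * e\<close> has degree zero, \<open>e_AnB\<close> and
  \<open>e_I\<close> identify its kernel, and \<open>prB e\<close> is central because
  \<open>e\<close> commutes with \<open>H\<close>.\<close>

lemma std_based_stratum:
  assumes "std_based sc H 1 {0}"
  shows "std_based sc {e * a * e | a. True} e (I \<inter> {e * a * e | a. True})"
proof -
  let ?C = "{e * a * e | a. True}"
  have C_unit: "e * y = y" "y * e = y" if "y \<in> ?C" for y
    using that by (auto simp: mult.assoc ee eex)
  interpret central_corner sc ?C "I \<inter> ?C" H e prB
  proof
    show "subspace ?C"
    proof (rule subspaceI)
      show "0 \<in> ?C" by (auto intro: exI[of _ 0])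
      fix x y c assume "x \<in> ?C"
      then obtain a where a: "x = e * a * e" by blast
      then have "sc c x = e * sc c a * e" by (simp flip: scale_mult_left scale_mult_right)
      then show "sc c x \<in> ?C" by blast
      assume "y \<in> ?C"
      then obtain b where "y = e * b * e" by blast
      with a have "x + y = e * (a + b) * e" by (simp add: distrib_left distrib_right)
      then show "x + y \<in> ?C" by blast
    qed
    show "x * y \<in> ?C" if "x \<in> ?C" "y \<in> ?C" for x y
      using that by clarsimp (metis mult.assoc)
    show "e \<in> ?C" by (auto intro!: exI[of _ 1] simp: ee)
    show "e * y = y" if "y \<in> ?C" for y using C_unit that by blast
    show "prB y \<in> H" if "y \<in> ?C" for y using prB_H eAe_grade0 that by blast
    show "prB (x + y) = prB x + prB y" for x y by (rule prB_add)
    show "prB (sc c y) = sc c (prB y)" for c y by (rule prB_scale)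
    show "prB (x * y) = prB x * prB y" if "x \<in> ?C" for x y
      using that eAe_grade0 by (auto intro: prB_mult)
    have prB_e: "prB (e * h) = prB e * h" "prB (h * e) = h * prB e" if "h \<in> H" for h
      using that prB_mult[of e h] prB_mult[of h e] prB_id[of h] e_grade0 by auto
    show "prB e * h = h * prB e" if "h \<in> H" for h
      using prB_e[OF that] H_comm[OF that] by simp
    show "\<exists>y\<in>?C. prB y = prB e * h" if "h \<in> H" for h
    proof (rule bexI)
      show "prB (e * h) = prB e * h" using prB_e that by blast
      have "e * h = e * h * e" using H_comm[OF that] by (simp add: mult.assoc eex)
      then show "e * h \<in> ?C" by blast
    qed
    have "y \<in> I \<longleftrightarrow> prB y = 0" if "y \<in> ?C" for y
      using e_AnB[of y] e_I[of y] C_unit[OF that] prB_zero_iff by auto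
    then show "I \<inter> ?C = {y \<in> ?C. prB y = 0}" by blast
  qed
  show ?thesis using std_based_corner[OF assms] .
qed

section \<open>Linear maps on J/I obtained from forms on A\<close>

definition B_linear :: "('a \<Rightarrow> 'a) \<Rightarrow> bool" where
  "B_linear \<phi> \<longleftrightarrow> (\<forall>m. \<phi> m \<in> B) \<and> (\<forall>m m'. \<phi> (m + m') = \<phi> m + \<phi> m') \<and> (\<forall>c m. \<phi> (sc c m) = sc c (\<phi> m))
     \<and> (\<forall>m. \<forall>b\<in>B. \<phi> (m * b) = \<phi> m * b)"

text \<open>On column j, only the degree \<open>j - d\<close> part of \<open>\<phi>\<close> is kept; the resulting map J/I \<open>\<rightarrow>\<close> eA/I is right
  A-linear because eA = eB modulo I.\<close>

definition stratum_map :: "('a \<Rightarrow> 'a) \<Rightarrow> 'a \<Rightarrow> 'a" where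
  "stratum_map \<phi> m = (\<Sum>j\<le>n. e * \<phi> (m * es j) * es j)"

context
  fixes \<phi> :: "'a \<Rightarrow> 'a"
  assumes \<phi>: "B_linear \<phi>"
begin

lemma form_add: "\<phi> (x + y) = \<phi> x + \<phi> y" and form_scale: "\<phi> (sc c x) = sc c (\<phi> x)"
  and form_B: "\<phi> x \<in> B" and form_mult: "b \<in> B \<Longrightarrow> \<phi> (x * b) = \<phi> x * b"
  using \<phi> unfolding B_linear_def by blast+

lemma form_zero: "\<phi> 0 = 0"
  using form_add[of 0 0] by simp

lemma map_add: "stratum_map \<phi> (x + y) = stratum_map \<phi> x + stratum_map \<phi> y"
  unfolding stratum_map_def by (simp add: distrib_left distrib_right form_add sum.distrib)

lemma map_scale: "stratum_map \<phi> (sc c x) = sc c (stratum_map \<phi> x)"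
  unfolding stratum_map_def
  by (simp add: scale_sum_right form_scale flip: scale_mult_left scale_mult_right)

lemma map_zero: "stratum_map \<phi> 0 = 0"
  using map_add[of 0 0] by simp

lemma map_diff: "stratum_map \<phi> (x - y) = stratum_map \<phi> x - stratum_map \<phi> y"
  using map_add[of "x - y" y] by (simp add: algebra_simps)

lemma e_map: "e * stratum_map \<phi> m = stratum_map \<phi> m"
  unfolding stratum_map_def by (simp add: sum_distrib_left mult.assoc eex)

lemma map_column: "k \<le> n \<Longrightarrow> stratum_map \<phi> (a * es k) = e * \<phi> (a * es k) * es k"
proof -
  assume k: "k \<le> n"
  have "stratum_map \<phi> (a * es k) = (\<Sum>j\<le>n. if j = k then e * \<phi> (a * es k) * es k else 0)"
    unfolding stratum_map_def using k
    by (intro sum.cong) (auto simp: mult.assoc es_mult form_zero)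
  then show ?thesis using k by simp
qed

text \<open>For \<open>b\<close> of degree \<open>t\<close>, moving \<open>es j\<close> across
  \<open>b\<close> replaces column \<open>j\<close> by column \<open>j - t\<close>, and linearity of
  \<open>\<phi>\<close> pulls \<open>b\<close> out.\<close>

lemma map_right_B: "b \<in> B \<Longrightarrow> stratum_map \<phi> (m * b) = stratum_map \<phi> m * b"
proof (induction rule: B_induct)
  case subspace
  show ?case
    by (rule subspaceI)
      (auto simp: map_zero map_add map_scale distrib_left simp flip: scale_mult_left scale_mult_right)
next
  case (homogeneous b t)
  have left: "e * \<phi> (m * b * es j) * es j = (if t \<le> j then e * \<phi> (m * es (j - t)) * es (j - t) * b else 0)"
    if "j \<le> n" for j
  proof (cases "t \<le> j")
    case True
    then have b: "b * es j = es (j - t) * b" using grade_shift[OF homogeneous(2)] that by simp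
    have "\<phi> (m * b * es j) * es j = \<phi> (m * es (j - t) * b) * es j" using b by (simp add: mult.assoc)
    also have "\<dots> = \<phi> (m * es (j - t)) * (b * es j)"
      using form_mult[OF homogeneous(1), of "m * es (j - t)"] by (simp add: mult.assoc)
    also have "\<dots> = \<phi> (m * es (j - t)) * es (j - t) * b" using b by (simp add: mult.assoc)
    finally show ?thesis using True by (simp add: mult.assoc)
  next
    case False
    then show ?thesis using grade_right_zero[OF homogeneous(2)] that by (simp add: mult.assoc form_zero)
  qed
  \<comment> \<open>Columns that \<open>b\<close> would push beyond \<open>n\<close> are missing
    from the reindexed sum; they contribute nothing because row \<open>k\<close> of \<open>b\<close>
    vanishes.\<close>
  have zero: "es k * b = 0" if "k \<le> n" "\<not> k + t \<le> n" for k
  proof -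
    have "es k * b = (\<Sum>l\<le>n. es k * b * es l)" by (rule sum_es_right)
    also have "\<dots> = 0" using homogeneous(2) that by (intro sum.neutral) (auto simp: grade_iff)
    finally show ?thesis .
  qed
  have "stratum_map \<phi> (m * b) = (\<Sum>j\<le>n. if t \<le> j then e * \<phi> (m * es (j - t)) * es (j - t) * b else 0)"
    unfolding stratum_map_def using left by simp
  also have "\<dots> = (\<Sum>j\<in>{t..n}. e * \<phi> (m * es (j - t)) * es (j - t) * b)"
    by (rule sum.mono_neutral_cong_right) auto
  also have "\<dots> = (\<Sum>k\<in>{k. k + t \<le> n}. e * \<phi> (m * es k) * es k * b)"
    by (rule sum.reindex_bij_witness[where i = "\<lambda>k. k + t" and j = "\<lambda>j. j - t"]) auto
  also have "\<dots> = (\<Sum>k\<le>n. e * \<phi> (m * es k) * es k * b)"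
    using zero by (intro sum.mono_neutral_left) (auto simp: mult.assoc)
  finally show ?case unfolding stratum_map_def by (simp add: sum_distrib_right)
qed

text \<open>On \<open>a * es k * b\<close> the map gives
  \<open>e * \<phi> (a * es k) * es k * b\<close>, and row \<open>d\<close> of an element of
  \<open>B\<close> vanishes in columns \<open>k < d\<close>.\<close>

lemma map_I: "z \<in> I \<Longrightarrow> stratum_map \<phi> z = 0"
proof -
  have "I \<subseteq> {z. stratum_map \<phi> z = 0}"
    unfolding lower_ideal_span
  proof (rule span_minimal, clarify)
    fix a k b assume k: "k < d" "k \<le> n" "b \<in> B"
    then show "stratum_map \<phi> (a * es k * b) = 0"
      using map_right_B[OF k(3)] map_column[OF k(2)] B_lower_zero[OF form_B k(1) d] by simp
  qed (auto intro!: subspaceI simp: map_zero map_add map_scale)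
  then show "z \<in> I \<Longrightarrow> stratum_map \<phi> z = 0" by blast
qed

text \<open>Replacing \<open>x\<close> by \<open>prB x\<close> changes \<open>a * e * x\<close> by
  an element of \<open>I\<close>, which the map kills, and changes the other product by an element
  of \<open>I\<close> because \<open>stratum_map \<phi> (a * e)\<close> ends in \<open>e\<close>.
  For \<open>prB x\<close> linearity is exact.\<close>

lemma map_e_mult: "stratum_map \<phi> (a * e * x) - stratum_map \<phi> (a * e) * x \<in> I"
proof -
  have "a * e * (x - prB x) \<in> I" using I_left[OF e_prB] by (simp add: mult.assoc)
  from map_I[OF this] have "stratum_map \<phi> (a * e * x) = stratum_map \<phi> (a * e * prB x)"
    by (simp add: right_diff_distrib map_diff)
  also have "\<dots> = stratum_map \<phi> (a * e) * prB x" by (rule map_right_B[OF prB_B])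
  finally have "stratum_map \<phi> (a * e * x) - stratum_map \<phi> (a * e) * x = - (stratum_map \<phi> (a * e) * (x - prB x))"
    by (simp add: algebra_simps)
  moreover have "stratum_map \<phi> (a * e) * (x - prB x) = e * \<phi> (a * e) * (e * (x - prB x))"
    unfolding map_column[OF d] by (simp add: mult.assoc)
  ultimately show ?thesis using subspace_neg[OF subspace_I I_left[OF e_prB]] by simp
qed

lemma map_right: "m \<in> J \<Longrightarrow> stratum_map \<phi> (m * r) - stratum_map \<phi> m * r \<in> I"
proof (induction rule: J_induct)
  case subspace
  show ?case
  proof (rule subspaceI)
    fix x y c
    assume x: "x \<in> {m. stratum_map \<phi> (m * r) - stratum_map \<phi> m * r \<in> I}"
    then show "sc c x \<in> {m. stratum_map \<phi> (m * r) - stratum_map \<phi> m * r \<in> I}"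
      using subspace_scale[OF subspace_I, of "stratum_map \<phi> (x * r) - stratum_map \<phi> x * r" c]
      by (simp add: map_scale scale_right_diff_distrib flip: scale_mult_left)
    assume "y \<in> {m. stratum_map \<phi> (m * r) - stratum_map \<phi> m * r \<in> I}"
    with x have "(stratum_map \<phi> (x * r) - stratum_map \<phi> x * r) + (stratum_map \<phi> (y * r) - stratum_map \<phi> y * r) \<in> I"
      using subspace_add[OF subspace_I] by blast
    then show "x + y \<in> {m. stratum_map \<phi> (m * r) - stratum_map \<phi> m * r \<in> I}"
      by (simp add: map_add distrib_right algebra_simps)
  qed (simp add: map_zero subspace_0)
next
  case (lower z)
  then show ?case using map_I[OF lower] map_I[OF I_right[OF lower]] by (simp add: subspace_0)
next
  case (generator a x)
  have "(stratum_map \<phi> (a * e * (x * r)) - stratum_map \<phi> (a * e) * (x * r))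
      - (stratum_map \<phi> (a * e * x) - stratum_map \<phi> (a * e) * x) * r \<in> I"
    by (intro subspace_diff[OF subspace_I] map_e_mult I_right)
  then show ?case by (simp add: algebra_simps)
qed

end

end

section \<open>Dual bases of J/I on both sides\<close>

context stratum
begin

text \<open>Column \<open>d\<close> of an element of \<open>B\<close> vanishes in rows
  \<open>k > d\<close>, and its rows \<open>k < d\<close> start with \<open>es k\<close>, which is
  in \<open>I\<close>.\<close>

lemma B_column:
  assumes "b \<in> B" shows "b * e - e * b * e \<in> I"
proof -
  have "b * e = (\<Sum>k\<le>n. es k * (b * e))" by (rule sum_es_left)
  also have "\<dots> = e * (b * e) + (\<Sum>k\<in>{..n} - {d}. es k * (b * e))"
    using d by (intro sum.remove) auto
  finally have "b * e - e * (b * e) = (\<Sum>k\<in>{..n} - {d}. es k * (b * e))"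
    by (metis add_diff_cancel_left')
  then have "b * e - e * b * e = (\<Sum>k\<in>{..n} - {d}. es k * (b * e))" by (simp add: mult.assoc)
  moreover have "es k * (b * e) \<in> I" if "k \<in> {..n} - {d}" for k
  proof (cases "k < d")
    case True
    then show ?thesis using that ideal_gen_base[of "es k" "{es k |k. k < d \<and> k \<le> n}" 1 "b * e"] by auto
  next
    case False
    then show ?thesis using B_lower_zero[OF assms, of d k] that
      by (simp add: mult.assoc subspace_0)
  qed
  ultimately show ?thesis by (simp only:) (rule subspace_sum[OF subspace_I])
qed

definition H_linear :: "('a \<Rightarrow> 'a) \<Rightarrow> bool" where
  "H_linear \<psi> \<longleftrightarrow> (\<forall>b\<in>B. \<psi> b \<in> H) \<and> (\<forall>b\<in>B. \<forall>b'\<in>B. \<psi> (b + b') = \<psi> b + \<psi> b')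
     \<and> (\<forall>c. \<forall>b\<in>B. \<psi> (sc c b) = sc c (\<psi> b)) \<and> (\<forall>h\<in>H. \<forall>b\<in>B. \<psi> (h * b) = h * \<psi> b)"

context
  fixes p :: nat and \<phi> :: "nat \<Rightarrow> 'a \<Rightarrow> 'a" and x :: "nat \<Rightarrow> 'a"
  assumes \<phi>: "\<And>i. i < p \<Longrightarrow> B_linear (\<phi> i)" and x: "\<And>m. m = (\<Sum>i<p. x i * \<phi> i m)"
begin

text \<open>Expand \<open>a * e\<close> in the dual basis and multiply by \<open>e\<close>; by
  \<open>B_column\<close>, cutting \<open>\<phi> i (a * e) * e\<close> down to its corner costs only
  elements of \<open>I\<close>.\<close>

lemma column_dual_basis: "a * e - (\<Sum>i<p. x i * stratum_map (\<phi> i) (a * e)) \<in> I"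
proof -
  have "a * e = (\<Sum>i<p. x i * \<phi> i (a * e)) * e" using x[of "a * e"] ee by (metis mult.assoc)
  then have "a * e - (\<Sum>i<p. x i * stratum_map (\<phi> i) (a * e))
    = (\<Sum>i<p. x i * (\<phi> i (a * e) * e)) - (\<Sum>i<p. x i * stratum_map (\<phi> i) (a * e))"
    by (simp add: sum_distrib_right mult.assoc)
  also have "\<dots> = (\<Sum>i<p. x i * (\<phi> i (a * e) * e - e * \<phi> i (a * e) * e))"
    using map_column[OF \<phi> d] by (simp add: sum_subtractf right_diff_distrib)
  also have "\<dots> \<in> I"
    using B_column form_B[OF \<phi>] by (intro subspace_sum[OF subspace_I] I_left) auto
  finally show ?thesis .
qed

lemma stratum_dual_basis: "m \<in> J \<Longrightarrow> m - (\<Sum>i<p. x i * stratum_map (\<phi> i) m) \<in> I"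
proof (induction rule: J_induct)
  case subspace
  let ?F = "\<lambda>m. m - (\<Sum>i<p. x i * stratum_map (\<phi> i) m)"
  show ?case
  proof (rule subspaceI)
    show "0 \<in> {m. ?F m \<in> I}" using map_zero[OF \<phi>] by (simp add: subspace_0)
    fix y z c assume y: "y \<in> {m. ?F m \<in> I}"
    have F: "?F (sc c y) = sc c (?F y)"
      using map_scale[OF \<phi>] by (simp add: scale_right_diff_distrib scale_sum_right scale_mult_right)
    then show "sc c y \<in> {m. ?F m \<in> I}"
      unfolding mem_Collect_eq F using y subspace_scale[OF subspace_I] by blast
    assume z: "z \<in> {m. ?F m \<in> I}"
    have F: "?F (y + z) = ?F y + ?F z"
      using map_add[OF \<phi>] by (simp add: distrib_left sum.distrib)
    then show "y + z \<in> {m. ?F m \<in> I}"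
      unfolding mem_Collect_eq F using y z subspace_add[OF subspace_I] by blast
  qed
next
  case (lower z)
  then show ?case using map_I[OF \<phi>] by simp
next
  case (generator a y)
  have "(a * e - (\<Sum>i<p. x i * stratum_map (\<phi> i) (a * e))) * y
      - (\<Sum>i<p. x i * (stratum_map (\<phi> i) (a * e * y) - stratum_map (\<phi> i) (a * e) * y)) \<in> I"
    by (intro subspace_diff[OF subspace_I] I_right column_dual_basis subspace_sum[OF subspace_I] I_left
        map_e_mult \<phi>) simp
  then show ?case
    by (simp add: left_diff_distrib right_diff_distrib sum_subtractf sum_distrib_right mult.assoc)
qed

text \<open>The basis elements are \<open>x i * e\<close> so that they lie in \<open>J\<close>; the
  sum is unchanged since the values of \<open>stratum_map\<close> start with
  \<open>e\<close>.\<close>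

lemma right_proj_stratum: "right_proj sc UNIV I J I"
  unfolding right_proj_def
proof (intro exI[of _ p] exI[of _ "\<lambda>i. stratum_map (\<phi> i)"] exI[of _ "\<lambda>i. x i * e"] conjI)
  show "\<forall>i<p. x i * e \<in> J" using e_J[of _ 1] by simp
  show "\<forall>m\<in>J. m - (\<Sum>i<p. x i * e * stratum_map (\<phi> i) m) \<in> I"
    using stratum_dual_basis e_map[OF \<phi>] by (simp add: mult.assoc)
qed (use map_I map_add map_scale map_right \<phi> subspace_0[OF subspace_I] in auto)

text \<open>Modulo \<open>I\<close> this sends \<open>a * e * y\<close> to
  \<open>a * e * \<psi> (prB (e * y))\<close>. Defined through the forms \<open>\<phi> i\<close>, it
  does not depend on writing \<open>m\<close> as a sum of such products.\<close>

definition left_map :: "('a \<Rightarrow> 'a) \<Rightarrow> 'a \<Rightarrow> 'a" where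
  "left_map \<psi> m = (\<Sum>i<p. x i * (e * \<psi> (prB (stratum_map (\<phi> i) m))))"

context
  fixes \<psi> :: "'a \<Rightarrow> 'a"
  assumes \<psi>: "H_linear \<psi>"
begin

lemma \<psi>_add: "b \<in> B \<Longrightarrow> b' \<in> B \<Longrightarrow> \<psi> (b + b') = \<psi> b + \<psi> b'"
  and \<psi>_scale: "b \<in> B \<Longrightarrow> \<psi> (sc c b) = sc c (\<psi> b)"
  and \<psi>_H: "b \<in> B \<Longrightarrow> \<psi> b \<in> H"
  and \<psi>_mult: "h \<in> H \<Longrightarrow> b \<in> B \<Longrightarrow> \<psi> (h * b) = h * \<psi> b"
  using \<psi> unfolding H_linear_def by blast+

lemma \<psi>_zero: "\<psi> 0 = 0"
  using \<psi>_add[of 0 0] subspace_0[OF subspace_B] by simp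

lemma left_map_add: "left_map \<psi> (m + m') = left_map \<psi> m + left_map \<psi> m'"
  unfolding left_map_def
  using map_add[OF \<phi>] prB_B by (simp add: prB_add \<psi>_add distrib_left sum.distrib)

lemma left_map_scale: "left_map \<psi> (sc c m) = sc c (left_map \<psi> m)"
  unfolding left_map_def
  using map_scale[OF \<phi>] prB_B by (simp add: prB_scale \<psi>_scale scale_sum_right scale_mult_right)

lemma left_map_I: "z \<in> I \<Longrightarrow> left_map \<psi> z = 0"
  unfolding left_map_def using map_I[OF \<phi>] prB_id[OF subspace_0[OF subspace_B]] by (simp add: \<psi>_zero)

text \<open>With \<open>c\<close> the image of \<open>a * e\<close>, each image of
  \<open>a * e * y\<close> is \<open>c * (e * y)\<close> modulo \<open>I\<close>. As
  \<open>c\<close> has degree zero, \<open>prB c\<close> comes out of \<open>prB\<close> and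
  \<open>\<psi>\<close>; behind \<open>e\<close> it may be replaced by \<open>c\<close>, and
  \<open>column_dual_basis\<close> sums these terms to \<open>a * e\<close>.\<close>

lemma left_map_generator: "left_map \<psi> (a * e * y) - a * e * \<psi> (prB (e * y)) \<in> I"
proof -
  let ?w = "\<psi> (prB (e * y))"
  have term_I: "x i * (e * \<psi> (prB (stratum_map (\<phi> i) (a * e * y)))) - x i * stratum_map (\<phi> i) (a * e) * ?w \<in> I"
    if i: "i < p" for i
  proof -
    define c where "c = stratum_map (\<phi> i) (a * e)"
    have c: "c = e * \<phi> i (a * e) * e" unfolding c_def by (rule map_column[OF \<phi>[OF i] d])
    have c0: "c \<in> grade sc n es 0" unfolding c by (rule eAe_grade0)
    define z where "z = stratum_map (\<phi> i) (a * e * y) - c * y"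
    have zI: "z \<in> I" unfolding z_def c_def by (rule map_e_mult[OF \<phi>[OF i]])
    \<comment> \<open>Being in \<open>I\<close> and starting with \<open>e\<close>, the error
      \<open>z\<close> lies in \<open>AnB\<close> and is killed by \<open>prB\<close>.\<close>
    have "e * z = z" unfolding z_def right_diff_distrib e_map[OF \<phi>[OF i]]
      by (simp add: c mult.assoc eex)
    then have "prB z = 0" using e_I[OF zI] prB_zero_iff by simp
    moreover have "stratum_map (\<phi> i) (a * e * y) = c * (e * y) + z"
      unfolding z_def by (simp add: c mult.assoc eex)
    ultimately have "prB (stratum_map (\<phi> i) (a * e * y)) = prB c * prB (e * y)"
      using prB_mult[OF c0] by (simp add: prB_add)
    then have "\<psi> (prB (stratum_map (\<phi> i) (a * e * y))) = prB c * ?w"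
      using \<psi>_mult[OF prB_H[OF c0] prB_B] by simp
    then have "x i * (e * \<psi> (prB (stratum_map (\<phi> i) (a * e * y)))) - x i * c * ?w
        = - (x i * (e * (c - prB c) * ?w))"
      by (simp add: c algebra_simps eex)
    moreover have "x i * (e * (c - prB c) * ?w) \<in> I" by (intro I_left I_right e_prB)
    ultimately show ?thesis unfolding c_def using subspace_neg[OF subspace_I] by simp
  qed
  have "(\<Sum>i<p. x i * (e * \<psi> (prB (stratum_map (\<phi> i) (a * e * y)))) - x i * stratum_map (\<phi> i) (a * e) * ?w)
      - (a * e - (\<Sum>i<p. x i * stratum_map (\<phi> i) (a * e))) * ?w \<in> I"
    by (intro subspace_diff[OF subspace_I] subspace_sum[OF subspace_I] term_I I_right column_dual_basis) simp
  then show ?thesis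
    unfolding left_map_def by (simp add: left_diff_distrib sum_subtractf sum_distrib_right mult.assoc)
qed

lemma left_map_mult: "m \<in> J \<Longrightarrow> left_map \<psi> (r * m) - r * left_map \<psi> m \<in> I"
proof (induction rule: J_induct)
  case subspace
  let ?F = "\<lambda>m. left_map \<psi> (r * m) - r * left_map \<psi> m"
  show ?case
  proof (rule subspaceI)
    show "0 \<in> {m. ?F m \<in> I}" using left_map_I[of 0] by (simp add: subspace_0)
    fix y z c assume y: "y \<in> {m. ?F m \<in> I}"
    have F: "?F (sc c y) = sc c (?F y)"
      by (simp add: left_map_scale scale_right_diff_distrib flip: scale_mult_right)
    then show "sc c y \<in> {m. ?F m \<in> I}"
      unfolding mem_Collect_eq F using y subspace_scale[OF subspace_I] by blast
    assume z: "z \<in> {m. ?F m \<in> I}"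
    have F: "?F (y + z) = ?F y + ?F z"
      by (simp add: left_map_add distrib_left)
    then show "y + z \<in> {m. ?F m \<in> I}"
      unfolding mem_Collect_eq F using y z subspace_add[OF subspace_I] by blast
  qed
next
  case (lower z)
  then show ?case using left_map_I[OF lower] left_map_I[OF I_left[OF lower]] by (simp add: subspace_0)
next
  case (generator a y)
  have "(left_map \<psi> (r * a * e * y) - r * a * e * \<psi> (prB (e * y)))
      - r * (left_map \<psi> (a * e * y) - a * e * \<psi> (prB (e * y))) \<in> I"
    by (intro subspace_diff[OF subspace_I] I_left left_map_generator)
  then show ?case by (simp add: right_diff_distrib mult.assoc)
qed

end

text \<open>Elements of \<open>H\<close> commute with \<open>e\<close>, so the sum over
  \<open>j\<close> reassembles each \<open>prB (stratum_map (\<phi> i) m)\<close>. Behind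
  \<open>e\<close> this equals \<open>stratum_map (\<phi> i) m\<close> modulo \<open>I\<close>, and
  \<open>stratum_dual_basis\<close> recovers \<open>m\<close>.\<close>

lemma left_proj_stratum:
  fixes q :: nat and y :: "nat \<Rightarrow> 'a"
  assumes \<psi>: "\<And>j. j < q \<Longrightarrow> H_linear (\<psi> j)" and y: "\<And>b. b \<in> B \<Longrightarrow> b = (\<Sum>j<q. \<psi> j b * y j)"
  shows "left_proj sc UNIV I J I"
  unfolding left_proj_def
proof (intro exI[of _ q] exI[of _ "\<lambda>j. left_map (\<psi> j)"] exI[of _ "\<lambda>j. e * y j"] conjI)
  show "\<forall>j<q. e * y j \<in> J" using e_J[of 1] by simp
  show "\<forall>m\<in>J. m - (\<Sum>j<q. left_map (\<psi> j) m * (e * y j)) \<in> I"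
  proof
    fix m assume m: "m \<in> J"
    let ?b = "\<lambda>i. prB (stratum_map (\<phi> i) m)"
    have "(\<Sum>j<q. left_map (\<psi> j) m * (e * y j)) = (\<Sum>j<q. \<Sum>i<p. x i * (e * (\<psi> j (?b i) * y j)))"
    proof (intro sum.cong refl)
      fix j assume j: "j \<in> {..<q}"
      have "\<psi> j (?b i) * (e * y j) = e * (\<psi> j (?b i) * y j)" for i
        using H_comm[OF \<psi>_H[OF \<psi> prB_B]] j by (simp flip: mult.assoc)
      then have "e * (\<psi> j (?b i) * (e * y j)) = e * (\<psi> j (?b i) * y j)" for i
        by (simp add: eex)
      then show "left_map (\<psi> j) m * (e * y j) = (\<Sum>i<p. x i * (e * (\<psi> j (?b i) * y j)))"
        unfolding left_map_def by (simp add: sum_distrib_right mult.assoc)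
    qed
    also have "\<dots> = (\<Sum>i<p. x i * (e * (\<Sum>j<q. \<psi> j (?b i) * y j)))"
      by (subst sum.swap) (simp add: sum_distrib_left)
    also have "\<dots> = (\<Sum>i<p. x i * (e * ?b i))"
      by (simp only: y[OF prB_B, symmetric])
    finally have "m - (\<Sum>j<q. left_map (\<psi> j) m * (e * y j))
      = (m - (\<Sum>i<p. x i * stratum_map (\<phi> i) m)) + (\<Sum>i<p. x i * (e * (stratum_map (\<phi> i) m - ?b i)))"
      using e_map[OF \<phi>] by (simp add: right_diff_distrib sum_subtractf)
    also have "\<dots> \<in> I"
      by (intro subspace_add[OF subspace_I] stratum_dual_basis m subspace_sum[OF subspace_I] I_left e_prB)
    finally show "m - (\<Sum>j<q. left_map (\<psi> j) m * (e * y j)) \<in> I" .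
  qed
qed (use left_map_I[OF \<psi>] left_map_add[OF \<psi>] left_map_scale[OF \<psi>] left_map_mult[OF \<psi>]
    subspace_0[OF subspace_I] in auto)

end

section \<open>Assembling the layers\<close>

lemma base_strat_ideal_stratum:
  assumes "std_based sc H 1 {0}"
  shows "base_strat_ideal sc I J"
proof -
  have "right_proj sc B {0} UNIV {0}" "left_proj sc H {0} B {0}"
    using borelic unfolding graded_pre_Borelic_def by blast+
  from this(1) obtain p :: nat and \<phi> :: "nat \<Rightarrow> 'a \<Rightarrow> 'a" and x :: "nat \<Rightarrow> 'a" where
    "\<forall>i<p. \<forall>m. \<phi> i m \<in> B" "\<forall>i<p. \<forall>m m'. \<phi> i (m + m') = \<phi> i m + \<phi> i m'"
    "\<forall>i<p. \<forall>c m. \<phi> i (sc c m) = sc c (\<phi> i m)" "\<forall>i<p. \<forall>b\<in>B. \<forall>m. \<phi> i (m * b) = \<phi> i m * b"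
    and x: "\<forall>m. m = (\<Sum>i<p. x i * \<phi> i m)"
    unfolding right_proj_def by auto
  then have \<phi>: "B_linear (\<phi> i)" if "i < p" for i
    unfolding B_linear_def using that by blast
  from \<open>left_proj sc H {0} B {0}\<close> obtain q :: nat and \<psi> :: "nat \<Rightarrow> 'a \<Rightarrow> 'a" and y :: "nat \<Rightarrow> 'a" where
    "\<forall>j<q. \<forall>m\<in>B. \<psi> j m \<in> H" "\<forall>j<q. \<forall>m\<in>B. \<forall>m'\<in>B. \<psi> j (m + m') = \<psi> j m + \<psi> j m'"
    "\<forall>j<q. \<forall>c. \<forall>m\<in>B. \<psi> j (sc c m) = sc c (\<psi> j m)" "\<forall>j<q. \<forall>h\<in>H. \<forall>m\<in>B. \<psi> j (h * m) = h * \<psi> j m"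
    and y: "\<forall>m\<in>B. m = (\<Sum>j<q. \<psi> j m * y j)"
    unfolding left_proj_def by auto
  then have \<psi>: "H_linear (\<psi> j)" if "j < q" for j
    unfolding H_linear_def using that by blast
  have "J = ksum (ideal_gen sc {e}) I"
  proof
    show "J \<subseteq> ksum (ideal_gen sc {e}) I"
    proof
      fix m assume "m \<in> J"
      then show "m \<in> ksum (ideal_gen sc {e}) I"
      proof (induction rule: J_induct)
        case subspace
        show ?case using subspace_ksum[OF subspace_ideal_gen subspace_I] by simp
      next
        case (lower z)
        then show ?case unfolding ksum_def using subspace_0[OF subspace_ideal_gen]
          by (intro CollectI exI[of _ 0] exI[of _ z]) simp
      next
        case (generator a x)
        show ?case unfolding ksum_def
          using subspace_0[OF subspace_I] ideal_gen_base[of e "{e}" a x]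
          by (intro CollectI exI[of _ "a * e * x"] exI[of _ 0]) simp
      qed
    qed
    have "ideal_gen sc {e} \<subseteq> J" using e_J by (intro ideal_gen_minimal subspace_ideal_gen) auto
    then show "ksum (ideal_gen sc {e}) I \<subseteq> J"
      unfolding ksum_def using I_J subspace_add[OF subspace_ideal_gen] by blast
  qed
  moreover have "left_proj sc UNIV I J I"
    by (rule left_proj_stratum[where p = p and q = q and \<phi> = \<phi> and \<psi> = \<psi> and x = x and y = y])
      (use \<phi> \<psi> x y in blast)+
  moreover have "right_proj sc UNIV I J I"
    by (rule right_proj_stratum[where p = p and \<phi> = \<phi> and x = x]) (use \<phi> x in blast)+
  ultimately show ?thesis
    unfolding base_strat_ideal_def
    using ee subspace_0[OF subspace_I] std_based_stratum[OF assms]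
    by (intro exI[of _ e] conjI) simp_all
qed

end

theorem theorem5p11:
  fixes sc :: "'k::field \<Rightarrow> 'a::ring_1 \<Rightarrow> 'a"
    and n :: nat and es :: "nat \<Rightarrow> 'a" and B :: "'a set"
  assumes "kalg sc"
    and "idem_grading n es"
    and "graded_pre_Borelic sc n es B"
    and "std_based sc (B \<inter> grade sc n es 0) 1 {0}"
  shows "base_stratified sc n es"
  unfolding base_stratified_def
proof
  fix i assume i: "i \<in> {1..n + 1}"
  interpret k_algebra sc
    using assms(1) unfolding kalg_def k_algebra_def k_algebra_axioms_def by blast
  \<comment> \<open>The ideal with index \<open>i\<close> adds the idempotent
    \<open>es (i - 1)\<close>; the bound \<open>i \<le> n + 1\<close> keeps it in range.\<close>
  interpret stratum sc n es B "i - 1" using assms i by unfold_locales auto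
  have "Suc (i - 1) = i" using i by simp
  then show "base_strat_ideal sc (Jideal sc n es (i - 1)) (Jideal sc n es i)"
    using base_strat_ideal_stratum[OF assms(4)] by (simp add: Jideal_eq[OF assms(2)])
qed

end
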